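(* Let $Z_F$ denote the meromorphic continuation to $\mathbb C$ of $\sum_{n\ge1}F_n^{-s}$, let $q=-\varphi^{-2}$, $P_F(s)=(\varphi^{-s};q)_\infty$ and $\Xi_F(s)=P_F(s)Z_F(s)$. The function $\Xi_F$ extends to an entire function. Its zeros, counted with multiplicity, are exactly the zeros of the meromorphic function $Z_F$: none of the poles $p_{k,m}$ ($k\ge0$, $m\in\mathbb Z$) of $Z_F$ becomes a zero after cancellation. More precisely, $$\Xi_F(p_{k,m})=q^{-k(k+1)/2}(q;q)_k(q;q)_\infty\,5^{p_{k,m}/2}\binom{-p_{k,m}}{k}\neq0.$$ If $M_\Xi(r)=\max_{|s|\le r}|\Xi_F(s)|$, then $$\limsup_{r\to\infty}\frac{\log M_\Xi(r)}{r^2}=\frac{\log\varphi}{4}.$$ Thus $\Xi_F$ has exact order $2$ and exact type $\log\varphi/4$. Let $n_\infty(R)$ be the number of poles of $Z_F$ in $|s|\le R$, and let $n_0(R)$ be the number of zeros of $Z_F$ there, both counted with multiplicity. Then $$n_\infty(R)=\frac{\log\varphi}{8}R^2+O(R),\qquad n_0(R)=O(R^2).$$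
   Context: $F_1=F_2=1$, $F_{n+2}=F_{n+1}+F_n$ are the Fibonacci numbers and $\varphi=(1+\sqrt5)/2$. It is known (Egami, Navas) that $\sum_{n\ge1}F_n^{-s}$ ($\operatorname{Re}s>0$) continues meromorphically to $\mathbb C$ via $$Z_F(s)=5^{s/2}\sum_{k\ge0}\binom{-s}{k}\frac1{\varphi^{s+2k}+(-1)^{k+1}},$$ with simple poles exactly at $$p_{k,m}=-2k+\frac{(2m+k)\pi i}{\log\varphi},\qquad k\ge0,\ m\in\mathbb Z.$$ Here $\binom{-s}{k}$ is the generalized binomial coefficient, and for $|q|<1$, $(a;q)_\infty=\prod_{j=0}^\infty(1-aq^j)$, $(q;q)_k=\prod_{j=1}^k(1-q^j)$. The asymptotics are as $R\to\infty$. *)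

theory Defs
  imports
    "HOL-Complex_Analysis.Complex_Analysis"
    "HOL-Number_Theory.Fib"
    "HOL-Library.Landau_Symbols"
    "HOL-Library.Liminf_Limsup"
begin

definition golden :: real where
  "golden = (1 + sqrt 5) / 2"

definition qpoch_inf :: "complex \<Rightarrow> complex \<Rightarrow> complex" where
  "qpoch_inf a q = (\<Prod>j. 1 - a * q ^ j)"

text \<open>The finite symbol \<open>(q;q)\<^sub>k\<close>.\<close>
definition qpoch_fin :: "complex \<Rightarrow> nat \<Rightarrow> complex" where
  "qpoch_fin q k = (\<Prod>j=1..k. 1 - q ^ j)"

text \<open>
  The meromorphic continuation of \<open>\<Sum>\<^bsub>n\<ge>1\<^esub> F\<^sub>n\<^sup>-\<^sup>s\<close> from the half-plane \<open>Re s > 0\<close>. Requiring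
  \<open>nicely_meromorphic_on\<close> (continuous at every non-pole, value \<open>0\<close> at every pole) makes the
  continuation unique as a total function.
\<close>
definition Z_F :: "complex \<Rightarrow> complex" where
  "Z_F = (THE f. f nicely_meromorphic_on UNIV \<and>
            (\<forall>s. Re s > 0 \<longrightarrow> f s = (\<Sum>n. of_nat (fib (Suc n)) powr (- s))))"

definition q_F :: complex where
  "q_F = - (1 / complex_of_real (golden ^ 2))"

definition P_F :: "complex \<Rightarrow> complex" where
  "P_F s = qpoch_inf (complex_of_real golden powr (- s)) q_F"

text \<open>\<open>remove_sings\<close> extends the product continuously over its removable singularities.\<close>
definition Xi_F :: "complex \<Rightarrow> complex" where
  "Xi_F = remove_sings (\<lambda>s. P_F s * Z_F s)"

definition pole_F :: "nat \<Rightarrow> int \<Rightarrow> complex" where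
  "pole_F k m = - 2 * of_nat k
     + (2 * of_int m + of_nat k) * complex_of_real pi * \<i> / complex_of_real (ln golden)"

text \<open>Poles are excluded explicitly, since \<open>Z_F\<close> formally takes the value \<open>0\<close> there.\<close>
definition zeros :: "(complex \<Rightarrow> complex) \<Rightarrow> complex set" where
  "zeros f = {s. \<not> is_pole f s \<and> f s = 0}"

definition poles :: "(complex \<Rightarrow> complex) \<Rightarrow> complex set" where
  "poles f = {s. is_pole f s}"

text \<open>
  Counting with multiplicity in \<open>|s| \<le> R\<close>. These are meaningful only if the index sets are
  finite, as a sum over an infinite set is \<open>0\<close> by convention.
\<close>
definition zero_count :: "(complex \<Rightarrow> complex) \<Rightarrow> real \<Rightarrow> int" where
  "zero_count f R = (\<Sum>s \<in> zeros f \<inter> cball 0 R. zorder f s)"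

definition pole_count :: "(complex \<Rightarrow> complex) \<Rightarrow> real \<Rightarrow> int" where
  "pole_count f R = (\<Sum>s \<in> poles f \<inter> cball 0 R. - zorder f s)"

text \<open>For continuous \<open>f\<close> and \<open>r \<ge> 0\<close> the supremum is attained.\<close>
definition max_modulus :: "(complex \<Rightarrow> complex) \<Rightarrow> real \<Rightarrow> real" where
  "max_modulus f r = (SUP s \<in> cball 0 r. norm (f s))"

definition growth_order :: "(complex \<Rightarrow> complex) \<Rightarrow> ereal" where
  "growth_order f = Limsup at_top (\<lambda>r::real. ereal (ln (ln (max_modulus f r)) / ln r))"

text \<open>The type with respect to the order \<open>\<rho>\<close>.\<close>
definition growth_type :: "real \<Rightarrow> (complex \<Rightarrow> complex) \<Rightarrow> ereal" where
  "growth_type \<rho> f = Limsup at_top (\<lambda>r::real. ereal (ln (max_modulus f r) / r powr \<rho>))"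

end

theory Submission
  imports Defs "HOL-Real_Asymp.Real_Asymp"
begin

text \<open>
  With \<open>a = \<phi>\<^sup>-\<^sup>s\<close>, cancelling the \<open>k\<close>-th factor of \<open>P\<^sub>F\<close> against the \<open>k\<close>-th denominator of the series
  for \<open>Z\<^sub>F\<close> gives the everywhere convergent expansion
  \<open>\<Xi>\<^sub>F(s) = 5\<^sup>s\<^sup>/\<^sup>2 \<Sum>\<^sub>k binom(-s, k) (-1)\<^sup>k a q\<^sup>k \<Prod>\<^sub>j\<^sub>\<noteq>\<^sub>k (1 - a q\<^sup>j)\<close>.
  At a pole \<open>p\<^sub>k\<^sub>,\<^sub>m\<close> only the \<open>k\<close>-th term survives, which gives the stated values; at \<open>-4 j\<close> these
  are of size \<open>exp (log \<phi> (4 j)\<^sup>2 / 4 + O(j))\<close>. Conversely every partial product is at most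
  \<open>\<Prod>\<^sub>j (1 + \<phi>\<^sup>r\<^sup>-\<^sup>2\<^sup>j) = exp (log \<phi> r\<^sup>2 / 4 + O(r))\<close>, while the coefficients only contribute
  \<open>\<Sum>\<^sub>k |binom(-s, k)| \<phi>\<^sup>-\<^sup>2\<^sup>k \<le> (1 - \<phi>\<^sup>-\<^sup>2)\<^sup>-\<^sup>r\<close>. Hence \<open>log M(r) = log \<phi> r\<^sup>2 / 4 + O(r)\<close>, and a Jensen-type
  bound controls the zeros. The poles in \<open>|s| \<le> R\<close> are lattice points in half an ellipse.
\<close>

section \<open>The infinite \<open>q\<close>-Pochhammer symbol\<close>

lemma convergent_prod_qpoch:
  fixes a q :: complex
  assumes "norm q < 1"
  shows "convergent_prod (\<lambda>j. 1 - a * q ^ j)"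
proof (rule abs_convergent_prod_imp_convergent_prod, rule summable_imp_abs_convergent_prod)
  have "summable (\<lambda>j. norm a * norm q ^ j)"
    using assms by (intro summable_mult summable_geometric) auto
  thus "summable (\<lambda>j. norm (1 - a * q ^ j - 1))"
    by (simp add: norm_mult norm_power)
qed

lemma qpoch_inf_LIMSEQ:
  assumes "norm q < 1"
  shows "(\<lambda>n. \<Prod>j<n. 1 - a * q ^ j) \<longlonglongrightarrow> qpoch_inf a q"
  using convergent_prod_LIMSEQ[OF convergent_prod_qpoch[OF assms, of a]]
  unfolding qpoch_inf_def
  by (subst (asm) LIMSEQ_lessThan_iff_atMost[symmetric])

lemma qpoch_inf_split_head:
  assumes "norm q < 1"
  shows "qpoch_inf a q = (1 - a) * qpoch_inf (a * q) q"
proof (rule LIMSEQ_unique)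
  show "(\<lambda>n. \<Prod>j<Suc n. 1 - a * q ^ j) \<longlonglongrightarrow> qpoch_inf a q"
    using qpoch_inf_LIMSEQ[OF assms] by (rule LIMSEQ_Suc)
  have "(\<lambda>n. (1 - a) * (\<Prod>j<n. 1 - a * q * q ^ j)) \<longlonglongrightarrow> (1 - a) * qpoch_inf (a * q) q"
    by (intro tendsto_intros qpoch_inf_LIMSEQ assms)
  thus "(\<lambda>n. \<Prod>j<Suc n. 1 - a * q ^ j) \<longlonglongrightarrow> (1 - a) * qpoch_inf (a * q) q"
    by (subst prod.lessThan_Suc_shift) (simp add: mult_ac)
qed

lemma qpoch_inf_split:
  assumes "norm q < 1"
  shows "qpoch_inf a q = (\<Prod>j<n. 1 - a * q ^ j) * qpoch_inf (a * q ^ n) q"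
proof (induction n)
  case (Suc n)
  have "qpoch_inf (a * q ^ n) q = (1 - a * q ^ n) * qpoch_inf (a * q ^ Suc n) q"
    using qpoch_inf_split_head[OF assms, of "a * q ^ n"] by (simp add: mult_ac)
  with Suc show ?case by (simp add: mult_ac)
qed simp

text \<open>\<open>convergent_prod\<close> excludes limits that degenerate to zero, so the product
  vanishes only through a factor; conversely a zero factor lies in the finite part split off by
  \<open>qpoch_inf_split\<close>.\<close>

lemma qpoch_inf_eq_0_iff:
  assumes "norm q < 1"
  shows "qpoch_inf a q = 0 \<longleftrightarrow> (\<exists>j. a * q ^ j = 1)"
proof
  assume "\<exists>j. a * q ^ j = 1"
  then obtain j where "a * q ^ j = 1" ..
  hence "(\<Prod>i<Suc j. 1 - a * q ^ i) = 0"
    by simp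
  thus "qpoch_inf a q = 0"
    using qpoch_inf_split[OF assms, of a "Suc j"] by simp
next
  assume "qpoch_inf a q = 0"
  thus "\<exists>j. a * q ^ j = 1"
    using prodinf_nonzero[OF convergent_prod_qpoch[OF assms, of a]]
    by (force simp: qpoch_inf_def)
qed

lemma qpoch_inf_self_nonzero:
  assumes "norm q < 1"
  shows "qpoch_inf q q \<noteq> 0"
proof
  assume "qpoch_inf q q = 0"
  then obtain j where "q ^ Suc j = 1"
    using qpoch_inf_eq_0_iff[OF assms] by auto
  hence "norm q ^ Suc j = 1"
    by (metis norm_one norm_power)
  moreover have "norm q ^ Suc j < 1"
    using assms by (cases "q = 0") (auto intro!: power_Suc_less_one simp del: power_Suc)
  ultimately show False by simp
qed

text \<open>With \<open>qpoch_inf_self_nonzero\<close> this keeps \<open>(q;q)_k\<close> away from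
  zero uniformly in \<open>k\<close>, as the lower growth bound requires.\<close>

lemma qpoch_fin_LIMSEQ:
  assumes "norm q < 1"
  shows "qpoch_fin q \<longlonglongrightarrow> qpoch_inf q q"
proof -
  have "qpoch_fin q n = (\<Prod>j<n. 1 - q * q ^ j)" for n
    unfolding qpoch_fin_def by (rule prod.reindex_bij_witness[of _ Suc "\<lambda>j. j - 1"])
      (auto simp: power_Suc[symmetric] simp del: power_Suc)
  thus ?thesis
    using qpoch_inf_LIMSEQ[OF assms, of q] by presburger
qed

lemma qpoch_fin_nonzero:
  assumes "norm q < 1"
  shows "qpoch_fin q k \<noteq> 0"
proof -
  have "q ^ j \<noteq> 1" if "j \<in> {1..k}" for j
  proof
    assume "q ^ j = 1"
    hence "norm q ^ j = 1"
      by (metis norm_one norm_power)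
    moreover have "norm q ^ j < 1"
      using assms that by (simp add: power_less_one_iff)
    ultimately show False by simp
  qed
  thus ?thesis
    by (auto simp: qpoch_fin_def)
qed

lemma qpoch_inf_holomorphic:
  assumes "norm q < 1"
  shows "(\<lambda>a. qpoch_inf a q) holomorphic_on UNIV"
proof (rule holomorphic_uniform_sequence)
  fix x :: complex
  have "uniformly_convergent_on (cball x 1) (\<lambda>N a. \<Prod>n<N. 1 - a * q ^ n)"
  proof (rule uniformly_convergent_on_prod')
    show "uniformly_convergent_on (cball x 1) (\<lambda>N a. \<Sum>n<N. norm (1 - a * q ^ n - 1))"
    proof (rule Weierstrass_m_test')
      show "summable (\<lambda>n. (norm x + 1) * norm q ^ n)"
        using assms by (intro summable_mult summable_geometric) auto
      fix n a assume "a \<in> cball x 1"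
      hence "norm a \<le> norm x + 1"
        using norm_triangle_sub[of a x] by (simp add: dist_norm norm_minus_commute)
      thus "norm (norm (1 - a * q ^ n - 1)) \<le> (norm x + 1) * norm q ^ n"
        by (auto simp: norm_mult norm_power intro!: mult_right_mono)
    qed
  qed (auto intro!: continuous_intros)
  then obtain l where l: "uniform_limit (cball x 1) (\<lambda>N a. \<Prod>n<N. 1 - a * q ^ n) l sequentially"
    by (auto simp: uniformly_convergent_on_def)
  have "l a = qpoch_inf a q" if "a \<in> cball x 1" for a
    using LIMSEQ_unique[OF tendsto_uniform_limitI[OF l that] qpoch_inf_LIMSEQ[OF assms]] .
  hence "uniform_limit (cball x 1) (\<lambda>N a. \<Prod>n<N. 1 - a * q ^ n) (\<lambda>a. qpoch_inf a q) sequentially"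
    using l by (metis (no_types, lifting) uniform_limit_cong')
  thus "\<exists>d>0. cball x d \<subseteq> UNIV \<and>
          uniform_limit (cball x d) (\<lambda>N a. \<Prod>n<N. 1 - a * q ^ n) (\<lambda>a. qpoch_inf a q) sequentially"
    by (intro exI[of _ 1]) auto
qed (auto intro!: holomorphic_intros)

text \<open>\<open>(a;q)_inf\<close> without its factor of index \<open>k\<close>. Splitting the
  product, rather than dividing by \<open>1 - a q^k\<close>, keeps it meaningful and entire in
  \<open>a\<close> where that factor vanishes.\<close>

definition qpoch_omit :: "nat \<Rightarrow> complex \<Rightarrow> complex \<Rightarrow> complex" where
  "qpoch_omit k a q = (\<Prod>j<k. 1 - a * q ^ j) * qpoch_inf (a * q ^ Suc k) q"

lemma qpoch_inf_eq_omit: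
  assumes "norm q < 1"
  shows "qpoch_inf a q = (1 - a * q ^ k) * qpoch_omit k a q"
  using qpoch_inf_split[OF assms, of a "Suc k"] by (simp add: qpoch_omit_def mult_ac)

lemma qpoch_omit_holomorphic:
  assumes "norm q < 1"
  shows "(\<lambda>a. qpoch_omit k a q) holomorphic_on UNIV"
proof -
  have "(\<lambda>a. qpoch_inf a q) \<circ> (\<lambda>a. a * q ^ Suc k) holomorphic_on UNIV"
    by (rule holomorphic_on_compose_gen[where t = UNIV])
       (auto intro!: holomorphic_intros qpoch_inf_holomorphic assms)
  thus ?thesis
    unfolding qpoch_omit_def o_def by (intro holomorphic_intros)
qed

lemma qpoch_omit_LIMSEQ:
  assumes "norm q < 1"
  shows "(\<lambda>n. \<Prod>j\<in>{..<n + Suc k} - {k}. 1 - a * q ^ j) \<longlonglongrightarrow> qpoch_omit k a q"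
proof -
  have eq: "(\<Prod>j\<in>{..<n + Suc k} - {k}. 1 - a * q ^ j) =
        (\<Prod>j<k. 1 - a * q ^ j) * (\<Prod>j<n. 1 - a * q ^ Suc k * q ^ j)" for n
  proof -
    have "{..<n + Suc k} - {k} = {..<k} \<union> {Suc k..<n + Suc k}"
      by auto
    moreover have "(\<Prod>j\<in>{Suc k..<n + Suc k}. 1 - a * q ^ j) = (\<Prod>j<n. 1 - a * q ^ Suc k * q ^ j)"
      by (rule prod.reindex_bij_witness[of _ "\<lambda>j. j + Suc k" "\<lambda>j. j - Suc k"])
         (auto simp: power_add[symmetric] mult.assoc simp del: power_Suc)
    moreover have "(\<Prod>j\<in>{..<k} \<union> {Suc k..<n + Suc k}. 1 - a * q ^ j) =
        (\<Prod>j<k. 1 - a * q ^ j) * (\<Prod>j\<in>{Suc k..<n + Suc k}. 1 - a * q ^ j)"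
      by (rule prod.union_disjoint) auto
    ultimately show ?thesis
      by simp
  qed
  show ?thesis
    unfolding eq qpoch_omit_def by (intro tendsto_intros qpoch_inf_LIMSEQ assms)
qed

lemma norm_qpoch_omit_le:
  assumes "norm q < 1" and K: "\<And>n. (\<Prod>j<n. 1 + norm a * norm q ^ j) \<le> K"
  shows "norm (qpoch_omit k a q) \<le> K"
proof (rule LIMSEQ_le_const2)
  show "(\<lambda>n. norm (\<Prod>j\<in>{..<n + Suc k} - {k}. 1 - a * q ^ j)) \<longlonglongrightarrow> norm (qpoch_omit k a q)"
    by (intro tendsto_norm qpoch_omit_LIMSEQ assms)
  have "norm (\<Prod>j\<in>{..<n + Suc k} - {k}. 1 - a * q ^ j) \<le> K" for n
  proof -
    have "norm (\<Prod>j\<in>{..<n + Suc k} - {k}. 1 - a * q ^ j)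
            \<le> (\<Prod>j\<in>{..<n + Suc k} - {k}. 1 + norm a * norm q ^ j)"
      unfolding prod_norm[symmetric]
      by (intro prod_mono)
         (auto intro!: order.trans[OF norm_triangle_ineq4] simp: norm_mult norm_power)
    also have "\<dots> \<le> (\<Prod>j<n + Suc k. 1 + norm a * norm q ^ j)"
      by (intro prod_mono2) auto
    also have "\<dots> \<le> K" by (rule K)
    finally show ?thesis .
  qed
  thus "\<exists>N. \<forall>n\<ge>N. norm (\<Prod>j\<in>{..<n + Suc k} - {k}. 1 - a * q ^ j) \<le> K"
    by blast
qed

text \<open>The vanishing factor of index \<open>j\<close> is still present: in the finite part if
  \<open>j < k\<close>, in the tail otherwise.\<close>

lemma qpoch_omit_eq_0:
  assumes "norm q < 1" "a * q ^ j = 1" "j \<noteq> k"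
  shows "qpoch_omit k a q = 0"
proof (cases "j < k")
  case True
  hence "(\<Prod>j<k. 1 - a * q ^ j) = 0"
    using assms(2) by (intro prod_zero bexI[of _ j]) auto
  thus ?thesis by (simp add: qpoch_omit_def)
next
  case False
  with assms have "a * q ^ Suc k * q ^ (j - Suc k) = 1"
    by (simp add: mult.assoc power_add[symmetric] del: power_Suc)
  hence "qpoch_inf (a * q ^ Suc k) q = 0"
    using qpoch_inf_eq_0_iff[OF assms(1)] by blast
  thus ?thesis by (simp add: qpoch_omit_def)
qed

text \<open>Here \<open>a = q^(-k)\<close>, so the finite part consists of the factors
  \<open>1 - q^(-i) = -q^(-i) (1 - q^i)\<close> for \<open>i = 1..k\<close>, and the tail starts at
  \<open>q\<close>.\<close>

lemma qpoch_omit_at_zero: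
  assumes "a * q ^ k = 1"
  shows "qpoch_omit k a q =
           (-1) ^ k * q powi (- (int k * (int k + 1) div 2)) * qpoch_fin q k * qpoch_inf q q"
proof -
  \<comment> \<open>\<open>q = 0\<close> is compatible with the hypothesis only for
    \<open>k = 0\<close>, when there is no factor to invert.\<close>
  have "q \<noteq> 0 \<or> k = 0"
    using assms by (cases k) auto
  have "(\<Prod>j<k. 1 - a * q ^ j) = (\<Prod>i=1..k. 1 - a * q ^ (k - i))"
    by (rule prod.reindex_bij_witness[of _ "\<lambda>i. k - i" "\<lambda>i. k - i"]) auto
  also have "\<dots> = (\<Prod>i=1..k. (-1) * inverse (q ^ i) * (1 - q ^ i))"
  proof (rule prod.cong)
    fix i assume i: "i \<in> {1..k}"
    with \<open>q \<noteq> 0 \<or> k = 0\<close> have "q \<noteq> 0" by auto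
    have "a * q ^ (k - i) * q ^ i = 1"
      using i assms by (simp add: mult.assoc power_add[symmetric])
    hence "a * q ^ (k - i) = inverse (q ^ i)"
      using \<open>q \<noteq> 0\<close> by (simp add: field_simps)
    thus "1 - a * q ^ (k - i) = (-1) * inverse (q ^ i) * (1 - q ^ i)"
      using \<open>q \<noteq> 0\<close> by (simp add: field_simps)
  qed simp
  also have "\<dots> = (-1) ^ k * inverse (\<Prod>i=1..k. q ^ i) * qpoch_fin q k"
    by (simp add: prod.distrib prod_uminus qpoch_fin_def prod_inversef[unfolded o_def, symmetric])
  also have "(\<Prod>i=1..k. q ^ i) = q ^ (k * (k + 1) div 2)"
    by (simp add: power_sum[symmetric] Sum_Icc_nat)
  also have "inverse (q ^ (k * (k + 1) div 2)) = q powi (- (int k * (int k + 1) div 2))"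
  proof -
    have "int k * (int k + 1) div 2 = int (k * (k + 1) div 2)"
      by (simp add: zdiv_int algebra_simps)
    thus ?thesis
      by (metis power_int_minus power_int_of_nat)
  qed
  finally have "(\<Prod>j<k. 1 - a * q ^ j) =
      (-1) ^ k * q powi (- (int k * (int k + 1) div 2)) * qpoch_fin q k" .
  moreover have "a * q ^ Suc k = q"
    using assms by simp
  ultimately show ?thesis
    by (simp only: qpoch_omit_def)
qed

section \<open>Entire functions\<close>

text \<open>The majorant may depend on the radius: the M-test then gives locally uniform
  convergence, which is enough.\<close>

lemma entire_suminf:
  fixes f :: "nat \<Rightarrow> complex \<Rightarrow> complex"
  assumes "\<And>n. f n holomorphic_on UNIV"
    and "\<And>r. \<exists>M. summable M \<and> (\<forall>n z. norm z \<le> r \<longrightarrow> norm (f n z) \<le> M n)"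
  shows "(\<lambda>z. \<Sum>n. f n z) holomorphic_on UNIV"
proof (rule holomorphic_uniform_sequence)
  fix x :: complex
  obtain M where M: "summable M" "\<And>n z. norm z \<le> norm x + 1 \<Longrightarrow> norm (f n z) \<le> M n"
    using assms(2)[of "norm x + 1"] by blast
  have "uniform_limit (cball x 1) (\<lambda>n z. \<Sum>i<n. f i z) (\<lambda>z. \<Sum>i. f i z) sequentially"
  proof (rule Weierstrass_m_test)
    fix n z assume "z \<in> cball x 1"
    hence "norm z \<le> norm x + 1"
      using norm_triangle_sub[of z x] by (simp add: dist_norm norm_minus_commute)
    thus "norm (f n z) \<le> M n" by (rule M)
  qed (fact M)
  thus "\<exists>d>0. cball x d \<subseteq> UNIV \<and>
          uniform_limit (cball x d) (\<lambda>n z. \<Sum>i<n. f i z) (\<lambda>z. \<Sum>i. f i z) sequentially"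
    by (intro exI[of _ 1]) auto
qed (auto intro!: holomorphic_intros assms)

text \<open>An identity theorem that includes the values at poles, which makes the definite
  description in \<open>Z_F\<close> usable. The difference vanishes identically once its
  singularities are removed, so \<open>f\<close> and \<open>g\<close> agree on a punctured
  neighbourhood of every point, and the normalisation fixes the value at the point itself.\<close>

lemma nicely_meromorphic_eqI:
  assumes "f nicely_meromorphic_on UNIV" "g nicely_meromorphic_on UNIV"
    and "open A" "A \<noteq> {}" "\<And>z. z \<in> A \<Longrightarrow> f z = g z"
  shows "f = g"
proof -
  define h where "h = remove_sings (\<lambda>z. f z - g z)"
  have mero: "f meromorphic_on UNIV" "g meromorphic_on UNIV"
    using assms(1,2) by (auto simp: nicely_meromorphic_on_def)
  have h: "h nicely_meromorphic_on UNIV"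
    unfolding h_def by (intro remove_sings_nicely_meromorphic meromorphic_intros mero)
  obtain z0 where z0: "z0 \<in> A" using assms by auto
  have h_eq: "eventually (\<lambda>z. h z = f z - g z) (at w)" for w
    unfolding h_def
    by (intro eventually_remove_sings_eq_at meromorphic_on_isolated_singularity
                meromorphic_intros meromorphic_on_subset[OF mero(1)] meromorphic_on_subset[OF mero(2)])
         auto
  have near: "eventually (\<lambda>z. f z = g z) (at w)" for w
  proof -
    have "eventually (\<lambda>z. z \<in> A) (nhds z0)"
      using z0 \<open>open A\<close> by (simp add: eventually_nhds_in_open)
    hence "eventually (\<lambda>z. f z - g z = 0) (at z0)"
      unfolding eventually_at_filter by eventually_elim (use assms in auto)
    hence "eventually (\<lambda>z. h z = 0) (at z0)"
      using h_eq[of z0] by eventually_elim auto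
    hence "frequently (\<lambda>z. h z = 0) (at z0)"
      by (intro eventually_frequently) auto
    hence 0: "h z = 0" for z
      by (rule frequently_eq_meromorphic_imp_constant[OF _ h]) auto
    show ?thesis
      using h_eq[of w] by eventually_elim (use 0 in auto)
  qed
  show ?thesis
  proof
    fix w
    have f: "(is_pole f w \<and> f w = 0) \<or> f \<midarrow>w\<rightarrow> f w" and g: "(is_pole g w \<and> g w = 0) \<or> g \<midarrow>w\<rightarrow> g w"
      using assms(1,2) by (auto simp: nicely_meromorphic_on_def)
    have "is_pole f w \<longleftrightarrow> is_pole g w"
      using near by (intro is_pole_cong) auto
    moreover have "(f \<midarrow>w\<rightarrow> f w) \<longleftrightarrow> (g \<midarrow>w\<rightarrow> f w)"
      by (intro tendsto_cong near)
    ultimately show "f w = g w"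
      using f g by (metis LIM_unique at_neq_bot is_pole_def not_tendsto_and_filterlim_at_infinity)
  qed
qed

text \<open>
  Jensen's inequality without an integral: after the zeros in \<open>cball 0 R\<close> are divided out,
  each factor \<open>1 - z / z\<^sub>i\<close> has modulus at least \<open>2\<close> on the circle of radius \<open>3 R\<close>.
\<close>
lemma entire_zero_count_le:
  assumes f: "f holomorphic_on UNIV" "f 0 \<noteq> 0" and R: "R > 0"
    and M: "\<And>z. norm z = 3 * R \<Longrightarrow> norm (f z) \<le> M"
    and S: "finite S" "\<And>s. s \<in> S \<Longrightarrow> norm s \<le> R \<and> f s = 0"
  shows "real_of_int (\<Sum>s\<in>S. zorder f s) * ln 2 \<le> ln (M / norm (f 0))"
proof -
  define n where "n s = nat (zorder f s)" for s
  define h where "h z = (\<Prod>s\<in>S. (1 - z / s) ^ n s)" for z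
  \<comment> \<open>On \<open>S\<close> the quotient has the default value \<open>0\<close> of
    division by zero; \<open>remove_sings\<close> replaces it by the limit, making \<open>F\<close>
    entire.\<close>
  define F where "F = remove_sings (\<lambda>z. f z / h z)"
  have S0: "s \<noteq> 0" if "s \<in> S" for s
    using S(2)[OF that] f(2) by auto
  have h_hol: "h holomorphic_on A" for A
    unfolding h_def by (intro holomorphic_intros) (use S0 in auto)
  have h_nz: "h z \<noteq> 0" if "z \<notin> S" for z
    using that S(1) S0 by (auto simp: h_def)
  have ana: "(\<lambda>z. f z / h z) analytic_on {z}" if "z \<notin> S" for z
  proof -
    have "open (-S)"
      using S(1) by (simp add: finite_imp_closed open_Compl)
    moreover have "(\<lambda>z. f z / h z) holomorphic_on (-S)"
      using h_nz by (intro holomorphic_intros holomorphic_on_subset[OF f(1)] h_hol) auto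
    ultimately show ?thesis
      using that by (metis ComplI analytic_at)
  qed
  have zord: "zorder f s > 0" "\<exists>c. (\<lambda>z. f z / h z) \<midarrow>s\<rightarrow> c" if s: "s \<in> S" for s
  proof -
    define g where "g = zor_poly f s"
    have "\<exists>w\<in>UNIV. f w \<noteq> 0" using f(2) by blast
    from zorder_exist_zero[OF f(1) open_UNIV connected_UNIV UNIV_I this, of s] obtain r
      where r: "zorder f s > 0" "r > 0" "g holomorphic_on cball s r"
         "\<And>w. w \<in> cball s r \<Longrightarrow> f w = g w * (w - s) ^ n s"
      using S(2)[OF s] unfolding g_def n_def by auto
    \<comment> \<open>The factor of \<open>h\<close> at \<open>s\<close> cancels against the zero of
      \<open>f\<close>, leaving a cofactor \<open>h'\<close> that is nonzero at
      \<open>s\<close>.\<close>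
    define h' where "h' z = (\<Prod>t\<in>S-{s}. (1 - z / t) ^ n t)" for z
    have "h' s \<noteq> 0"
      using S(1) S0 by (auto simp: h'_def)
    have h_eq: "h z = (1 - z / s) ^ n s * h' z" for z
      unfolding h_def h'_def using S(1) s by (rule prod.remove)
    have "isCont g s"
      using r(2,3) by (metis analytic_at analytic_at_imp_isCont centre_in_ball holomorphic_on_subset
          ball_subset_cball open_ball)
    moreover have "isCont h' s"
      unfolding h'_def by (intro continuous_intros) (use S0 in auto)
    ultimately have "(\<lambda>z. g z * (-s) ^ n s / h' z) \<midarrow>s\<rightarrow> g s * (-s) ^ n s / h' s"
      using \<open>h' s \<noteq> 0\<close> by (intro tendsto_intros) (auto simp: isCont_def)
    moreover have "eventually (\<lambda>z. z \<in> ball s r) (nhds s)"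
      using r(2) by (intro eventually_nhds_in_open) auto
    hence "eventually (\<lambda>z. g z * (-s) ^ n s / h' z = f z / h z) (at s)"
      unfolding eventually_at_filter
    proof eventually_elim
      case (elim z)
      show ?case
      proof (intro impI)
        assume "z \<noteq> s"
        have "z - s = (-s) * (1 - z / s)"
          using S0[OF s] by (simp add: field_simps)
        hence "f z = g z * ((-s) ^ n s * (1 - z / s) ^ n s)"
          using r(4)[of z] elim by (simp only: power_mult_distrib[symmetric]) auto
        moreover have "1 - z / s \<noteq> 0"
          using \<open>z \<noteq> s\<close> S0[OF s] by auto
        ultimately show "g z * (-s) ^ n s / h' z = f z / h z"
          unfolding h_eq using \<open>z \<noteq> s\<close> by simp
      qed
    qed
    ultimately have "(\<lambda>z. f z / h z) \<midarrow>s\<rightarrow> g s * (-s) ^ n s / h' s"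
      by (rule Lim_transform_eventually)
    thus "\<exists>c. (\<lambda>z. f z / h z) \<midarrow>s\<rightarrow> c" by blast
    show "zorder f s > 0" by (fact r(1))
  qed
  have F_eq: "F z = f z / h z" if "z \<notin> S" for z
    unfolding F_def using ana[OF that] by (rule remove_sings_at_analytic)
  have "F analytic_on {z}" for z
  proof (cases "z \<in> S")
    case True
    have "isolated_singularity_at (\<lambda>z. f z / h z) z"
      by (intro isolated_singularity_at_divide isolated_singularity_at_analytic
            not_essential_analytic) (auto simp: analytic_on_open intro!: holomorphic_on_imp_analytic_at[where A = UNIV] f h_hol)
    thus ?thesis
      unfolding F_def using zord(2)[OF True] by (auto intro: remove_sings_analytic_at)
  qed (use ana in \<open>auto simp: F_def intro!: remove_sings_analytic_on\<close>)
  hence F_hol: "F holomorphic_on A" for A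
    by (meson analytic_imp_holomorphic analytic_on_analytic_at)
  define N where "N = (\<Sum>s\<in>S. n s)"
  \<comment> \<open>Maximum modulus principle: a bound for \<open>F\<close> on the circle of radius
    \<open>3 * R\<close>, which misses \<open>S\<close>, carries over to the centre.\<close>
  have "norm (F 0) \<le> M / 2 ^ N"
  proof (rule maximum_modulus_frontier[of F "cball 0 (3 * R)"])
    fix z :: complex assume "z \<in> frontier (cball 0 (3 * R))"
    hence z: "norm z = 3 * R"
      using R by (simp add: frontier_cball)
    hence "z \<notin> S"
      using S(2)[of z] R by auto
    have "2 ^ N = (\<Prod>s\<in>S. 2 ^ n s)"
      by (simp add: N_def power_sum)
    also have "(\<Prod>s\<in>S. 2 ^ n s) \<le> norm (h z)"
      unfolding h_def prod_norm[symmetric] norm_power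
    proof (intro prod_mono conjI power_mono)
      fix s assume s: "s \<in> S"
      have "3 * norm s \<le> norm z"
        using S(2)[OF s] z by simp
      hence "3 \<le> norm (z / s)"
        using S0[OF s] by (simp add: norm_divide field_simps)
      thus "2 \<le> norm (1 - z / s)"
        using norm_triangle_ineq2[of "z / s" 1] by (simp add: norm_minus_commute)
    qed auto
    finally have "2 ^ N \<le> norm (h z)" .
    moreover have "norm (f z) \<le> M"
      by (rule M) (fact z)
    ultimately show "norm (F z) \<le> M / 2 ^ N"
      unfolding F_eq[OF \<open>z \<notin> S\<close>] norm_divide
      by (intro frac_le) (auto intro: order.trans[OF norm_ge_zero])
  qed (use R in \<open>auto intro!: F_hol holomorphic_on_imp_continuous_on\<close>)
  moreover have "F 0 = f 0"
    using F_eq[of 0] S0 by (auto simp: h_def)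
  ultimately have "2 ^ N \<le> M / norm (f 0)"
    using f(2) by (simp add: field_simps)
  hence "ln (2 ^ N) \<le> ln (M / norm (f 0))"
    by (subst ln_le_cancel_iff) (auto intro: less_le_trans[of _ "2 ^ N"])
  \<comment> \<open>All orders are positive, so \<open>nat\<close> in \<open>n\<close> truncates
    nothing.\<close>
  moreover have "(\<Sum>s\<in>S. zorder f s) = int N"
    using zord(1) by (force simp: N_def n_def intro!: sum.cong)
  ultimately show ?thesis
    by (simp add: ln_realpow)
qed

text \<open>Fubini for a double series majorised by a product of two convergent series: absolute
  summability on the product set lets unordered sums be swapped and then read back as ordinary
  series.\<close>

lemma sums_swap_dominated:
  fixes f :: "nat \<Rightarrow> nat \<Rightarrow> 'a::banach" and a b :: "nat \<Rightarrow> real"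
  assumes le: "\<And>m n. norm (f m n) \<le> a m * b n"
    and a: "summable a" "\<And>m. 0 \<le> a m" and b: "summable b" "\<And>n. 0 \<le> b n"
  shows "(\<lambda>n. \<Sum>m. f m n) sums (\<Sum>m. \<Sum>n. f m n)"
proof -
  have inner1: "summable (\<lambda>n. norm (f m n))" for m
    by (rule summable_comparison_test[of _ "\<lambda>n. a m * b n"]) (use le b in \<open>auto intro: summable_mult\<close>)
  have inner2: "summable (\<lambda>m. norm (f m n))" for n
    by (rule summable_comparison_test[of _ "\<lambda>m. a m * b n"]) (use le a in \<open>auto intro: summable_mult2\<close>)
  have norm1: "norm (\<Sum>n. f m n) \<le> a m * suminf b" for m
  proof -
    have "norm (\<Sum>n. f m n) \<le> (\<Sum>n. norm (f m n))"
      by (rule summable_norm[OF inner1])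
    also have "\<dots> \<le> (\<Sum>n. a m * b n)"
      by (intro suminf_le inner1 le summable_mult b)
    finally show ?thesis using b by (simp add: suminf_mult)
  qed
  have norm2: "norm (\<Sum>m. f m n) \<le> suminf a * b n" for n
  proof -
    have "norm (\<Sum>m. f m n) \<le> (\<Sum>m. norm (f m n))"
      by (rule summable_norm[OF inner2])
    also have "\<dots> \<le> (\<Sum>m. a m * b n)"
      by (intro suminf_le inner2 le summable_mult2 a)
    finally show ?thesis using a by (simp add: suminf_mult2[symmetric])
  qed
  have outer1: "summable (\<lambda>m. norm (\<Sum>n. f m n))"
    by (rule summable_comparison_test[of _ "\<lambda>m. a m * suminf b"])
       (use norm1 a in \<open>auto intro: summable_mult2\<close>)
  have outer2: "summable (\<lambda>n. norm (\<Sum>m. f m n))"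
    by (rule summable_comparison_test[of _ "\<lambda>n. suminf a * b n"])
       (use norm2 b in \<open>auto intro: summable_mult\<close>)
  have infsum: "infsum g UNIV = suminf g" if "summable (\<lambda>n. norm (g n))" for g :: "nat \<Rightarrow> 'a"
    using norm_summable_imp_has_sum[OF that] summable_norm_cancel[OF that]
    by (simp add: infsumI sums_iff)
  have "(\<lambda>(m, n). a m * b n) summable_on (SIGMA m:UNIV. UNIV)"
  proof (rule summable_on_SigmaI)
    fix m
    have "(b has_sum suminf b) UNIV"
      using b by (intro norm_summable_imp_has_sum) auto
    thus "((\<lambda>n. case (m, n) of (m, n) \<Rightarrow> a m * b n) has_sum (a m * suminf b)) UNIV"
      by (simp add: has_sum_cmult_right)
    show "(\<lambda>m. a m * suminf b) summable_on UNIV"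
      using a b by (intro norm_summable_imp_summable_on) (auto intro!: summable_mult2 suminf_nonneg simp: abs_mult)
  qed (use a b in auto)
  hence "(\<lambda>x. norm (case x of (m, n) \<Rightarrow> f m n)) summable_on (UNIV \<times> UNIV)"
    by (rule Infinite_Sum.abs_summable_on_comparison_test') (use le in auto)
  hence "(\<lambda>(m, n). f m n) summable_on (UNIV \<times> UNIV)"
    by (rule abs_summable_summable)
  from infsum_swap_banach[OF this]
  have "(\<Sum>m. \<Sum>n. f m n) = (\<Sum>n. \<Sum>m. f m n)"
    by (simp add: infsum inner1 inner2 outer1 outer2)
  thus ?thesis
    using summable_norm_cancel[OF outer2] by (simp add: sums_iff)
qed

section \<open>The golden ratio\<close>

lemma golden_gt_1: "golden > 1"
  by (simp add: golden_def field_simps)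

lemma golden_pos: "golden > 0"
  using golden_gt_1 by linarith

lemma ln_golden_pos: "ln golden > 0"
  using golden_gt_1 by simp

lemma powr_eq_exp_ln: "x > 0 \<Longrightarrow> complex_of_real x powr s = exp (s * of_real (ln x))"
  by (auto simp: powr_def Ln_of_real)

lemma q_F_eq_of_real: "q_F = of_real (- 1 / golden ^ 2)"
  by (simp add: q_F_def)

lemma norm_q_F: "norm q_F = 1 / golden ^ 2"
  unfolding q_F_eq_of_real norm_of_real using golden_pos by simp

lemma norm_q_F_less_1: "norm q_F < 1"
  using golden_gt_1 by (simp add: norm_q_F one_less_power)

text \<open>The bracket is a logarithm of the negative number \<open>q_F\<close>; its imaginary part
  \<open>pi\<close> is the origin of the summand \<open>k\<close> in the imaginary part of
  \<open>pole_F\<close>.\<close>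

lemma q_F_power_eq_exp:
  "q_F ^ k = exp (of_nat k * (of_real pi * \<i> - 2 * of_real (ln golden)))"
proof -
  have "exp (- 2 * of_real (ln golden)) = complex_of_real (exp (- 2 * ln golden))"
    by (simp add: exp_of_real[symmetric])
  also have "exp (- 2 * ln golden) = 1 / golden ^ 2"
    using golden_pos by (simp add: exp_minus exp_double inverse_eq_divide power_divide)
  finally have "q_F = exp (of_real pi * \<i> - 2 * of_real (ln golden))"
    by (simp add: q_F_def exp_diff exp_minus field_simps)
  thus ?thesis
    by (simp add: exp_of_nat_mult)
qed

text \<open>The left side is a single exponential, equal to \<open>1\<close> exactly when its
  exponent is an integral multiple of \<open>2 pi i\<close>. Solving for \<open>s\<close> produces
  the index \<open>-m\<close>, which is harmless as \<open>m\<close> runs over all integers.\<close>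

lemma golden_powr_mult_q_F_eq_1_iff:
  "of_real golden powr (- s) * q_F ^ k = 1 \<longleftrightarrow> (\<exists>m. s = pole_F k m)"
proof -
  define L where "L = ln golden"
  have L: "L > 0" using ln_golden_pos by (simp add: L_def)
  have "of_real golden powr (- s) * q_F ^ k = exp (- s * of_real L + of_nat k * (of_real pi * \<i> - 2 * of_real L))"
    by (simp only: powr_eq_exp_ln[OF golden_pos] q_F_power_eq_exp exp_add L_def)
  also have "\<dots> = 1 \<longleftrightarrow> (\<exists>m::int. - s * of_real L + of_nat k * (of_real pi * \<i> - 2 * of_real L) = of_int (2 * m) * of_real pi * \<i>)"
    unfolding exp_eq_1 by (auto simp: complex_eq_iff)
  also have "\<dots> \<longleftrightarrow> (\<exists>m::int. s = pole_F k (- m))"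
    using L by (intro ex_cong1) (auto simp: pole_F_def L_def[symmetric] field_simps)
  also have "\<dots> \<longleftrightarrow> (\<exists>m. s = pole_F k m)"
    by (metis minus_minus)
  finally show ?thesis .
qed

lemma Re_pole_F [simp]: "Re (pole_F k m) = - 2 * real k"
  and Im_pole_F [simp]: "Im (pole_F k m) = (2 * of_int m + real k) * pi / ln golden"
  by (auto simp: pole_F_def complex_eq_iff Re_divide_of_real Im_divide_of_real)

lemma pole_F_eq_iff: "pole_F k m = pole_F k' m' \<longleftrightarrow> k = k' \<and> m = m'"
  using ln_golden_pos by (auto simp: complex_eq_iff)

lemma P_F_eq_0_iff: "P_F s = 0 \<longleftrightarrow> (\<exists>k m. s = pole_F k m)"
  by (simp add: P_F_def qpoch_inf_eq_0_iff[OF norm_q_F_less_1] golden_powr_mult_q_F_eq_1_iff)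

lemma golden_powr_holomorphic: "(\<lambda>s. complex_of_real golden powr (- s)) holomorphic_on UNIV"
  using golden_pos unfolding powr_eq_exp_ln[OF golden_pos] by (intro holomorphic_intros)

lemma P_F_holomorphic: "P_F holomorphic_on UNIV"
proof -
  have "(\<lambda>a. qpoch_inf a q_F) \<circ> (\<lambda>s. complex_of_real golden powr (- s)) holomorphic_on UNIV"
    by (rule holomorphic_on_compose_gen[OF golden_powr_holomorphic
          qpoch_inf_holomorphic[OF norm_q_F_less_1]]) auto
  moreover have "P_F = (\<lambda>a. qpoch_inf a q_F) \<circ> (\<lambda>s. complex_of_real golden powr (- s))"
    by (simp add: fun_eq_iff P_F_def)
  ultimately show ?thesis
    by simp
qed

section \<open>The entire function\<close>

lemma norm_pochhammer_le:
  assumes "norm s \<le> r"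
  shows "norm (pochhammer (s::complex) k) \<le> pochhammer r k"
  unfolding pochhammer_prod prod_norm[symmetric]
  by (intro prod_mono) (auto intro!: order.trans[OF norm_triangle_ineq] simp: assms)

lemma norm_gbinomial_uminus_le:
  assumes "norm (s::complex) \<le> r"
  shows "norm ((- s) gchoose k) \<le> pochhammer r k / fact k"
  using norm_pochhammer_le[OF assms, of k]
  by (simp add: gbinomial_pochhammer norm_mult norm_divide norm_power divide_right_mono)

text \<open>Newton's binomial series at \<open>-x\<close> with exponent \<open>-r\<close>, in which
  the alternating signs cancel.\<close>

lemma sums_pochhammer:
  fixes r x :: real
  assumes "0 \<le> x" "x < 1"
  shows "(\<lambda>k. pochhammer r k / fact k * x ^ k) sums (1 - x) powr (- r)"
proof -
  have "(\<lambda>k. ((- r) gchoose k) * (- x) ^ k) sums (1 + - x) powr (- r)"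
    using assms by (intro gen_binomial_real) auto
  moreover have "((- r) gchoose k) * (- x) ^ k = pochhammer r k / fact k * x ^ k" for k
    by (simp add: gbinomial_pochhammer power_minus[of x] mult_ac)
  ultimately show ?thesis
    by simp
qed

text \<open>With \<open>w = a q^k\<close> and \<open>a = phi^(-s)\<close>, the fraction
  \<open>1 / (phi^(s+2k) + (-1)^(k+1))\<close> is \<open>(-1)^k w / (1 - w)\<close>. Multiplication
  by \<open>P_F s\<close> replaces \<open>1 / (1 - w)\<close> by \<open>qpoch_omit\<close>.\<close>

definition Xi_term :: "nat \<Rightarrow> complex \<Rightarrow> complex" where
  "Xi_term k s = ((- s) gchoose k) * (-1) ^ k * (of_real golden powr (- s) * q_F ^ k)
                    * qpoch_omit k (of_real golden powr (- s)) q_F"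

definition Xi_series :: "complex \<Rightarrow> complex" where
  "Xi_series s = 5 powr (s / 2) * (\<Sum>k. Xi_term k s)"

lemma Xi_term_holomorphic: "Xi_term k holomorphic_on UNIV"
proof -
  have "(\<lambda>a. qpoch_omit k a q_F) \<circ> (\<lambda>s. complex_of_real golden powr (- s)) holomorphic_on UNIV"
    by (rule holomorphic_on_compose_gen[OF golden_powr_holomorphic
          qpoch_omit_holomorphic[OF norm_q_F_less_1]]) auto
  hence "(\<lambda>s. qpoch_omit k (complex_of_real golden powr (- s)) q_F) holomorphic_on UNIV"
    by (simp add: o_def)
  thus ?thesis
    unfolding Xi_term_def gbinomial_pochhammer pochhammer_prod
    by (intro holomorphic_intros golden_powr_holomorphic) auto
qed

lemma norm_golden_powr_le:
  assumes "norm s \<le> r"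
  shows "norm (complex_of_real golden powr (- s)) \<le> golden powr r"
proof -
  have "norm (complex_of_real golden powr (- s)) = golden powr (- Re s)"
    using golden_pos by (simp add: norm_powr_real_powr)
  also have "\<dots> \<le> golden powr r"
    using golden_gt_1 assms abs_Re_le_cmod[of s] by (intro powr_mono) auto
  finally show ?thesis .
qed

text \<open>\<open>K\<close> stays a parameter: a crude bound suffices for convergence, a sharp one
  is substituted for the growth estimate.\<close>

lemma norm_Xi_term_le:
  assumes s: "norm s \<le> r"
    and K: "\<And>n. (\<Prod>j<n. 1 + golden powr r * norm q_F ^ j) \<le> K"
  shows "norm (Xi_term k s) \<le> (pochhammer r k / fact k * norm q_F ^ k) * (golden powr r * K)"
proof -
  define a where "a = complex_of_real golden powr (- s)"
  have a: "norm a \<le> golden powr r"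
    unfolding a_def using s by (rule norm_golden_powr_le)
  have "norm (qpoch_omit k a q_F) \<le> K"
  proof (rule norm_qpoch_omit_le[OF norm_q_F_less_1])
    fix n
    have "(\<Prod>j<n. 1 + norm a * norm q_F ^ j) \<le> (\<Prod>j<n. 1 + golden powr r * norm q_F ^ j)"
      using a by (intro prod_mono) (auto intro!: mult_right_mono)
    also have "\<dots> \<le> K" by (rule K)
    finally show "(\<Prod>j<n. 1 + norm a * norm q_F ^ j) \<le> K" .
  qed
  moreover have "norm (Xi_term k s) =
      norm ((- s) gchoose k) * (norm a * norm q_F ^ k) * norm (qpoch_omit k a q_F)"
    by (simp add: Xi_term_def a_def norm_mult norm_power)
  moreover have "norm ((- s) gchoose k) * (norm a * norm q_F ^ k) * norm (qpoch_omit k a q_F)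
     \<le> (pochhammer r k / fact k) * (golden powr r * norm q_F ^ k) * K"
    using calculation(1) a norm_gbinomial_uminus_le[OF s, of k]
    by (intro mult_mono mult_nonneg_nonneg order.trans[OF norm_ge_zero norm_gbinomial_uminus_le[OF s, of k]]) auto
  ultimately show ?thesis
    by (simp add: mult_ac)
qed

text \<open>From \<open>1 + x <= exp x\<close> and the geometric series. It supplies the crude value
  of \<open>K\<close> and, with \<open>A <= 1\<close>, the tail of the sharp one.\<close>

lemma prod_one_plus_geometric_le:
  fixes A x :: real
  assumes "0 \<le> A" "0 \<le> x" "x < 1"
  shows "(\<Prod>j<n. 1 + A * x ^ j) \<le> exp (A / (1 - x))"
proof -
  have "(\<Prod>j<n. 1 + A * x ^ j) \<le> exp (\<Sum>j<n. A * x ^ j)"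
    using assms by (intro prod_le_exp_sum) auto
  also have "(\<Sum>j<n. A * x ^ j) \<le> A / (1 - x)"
  proof -
    have "(\<Sum>j<n. x ^ j) \<le> (\<Sum>j. x ^ j)"
      using assms by (intro sum_le_suminf summable_geometric) auto
    also have "\<dots> = 1 / (1 - x)"
      using assms by (simp add: suminf_geometric)
    finally show ?thesis
      using assms mult_left_mono[of "\<Sum>j<n. x ^ j" "1 / (1 - x)" A]
      by (simp add: sum_distrib_left)
  qed
  finally show ?thesis by simp
qed

lemma Xi_majorant_sums:
  "(\<lambda>k. pochhammer r k / fact k * norm q_F ^ k * C) sums ((1 - norm q_F) powr (- r) * C)"
  using norm_q_F_less_1 by (intro sums_mult2 sums_pochhammer) auto

lemma summable_norm_Xi_term: "summable (\<lambda>k. norm (Xi_term k s))"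
proof (rule summable_comparison_test)
  show "\<exists>N. \<forall>k\<ge>N. norm (norm (Xi_term k s)) \<le> pochhammer (norm s) k / fact k * norm q_F ^ k
           * (golden powr norm s * exp (golden powr norm s / (1 - norm q_F)))"
    using norm_Xi_term_le[OF order.refl prod_one_plus_geometric_le] norm_q_F_less_1 by auto
  show "summable (\<lambda>k. pochhammer (norm s) k / fact k * norm q_F ^ k
           * (golden powr norm s * exp (golden powr norm s / (1 - norm q_F))))"
    using Xi_majorant_sums by (rule sums_summable)
qed

lemma powr_5_holomorphic: "(\<lambda>s. 5 powr (s / 2) :: complex) holomorphic_on UNIV"
proof -
  have "(5::complex) powr (s / 2) = exp (s / 2 * of_real (ln 5))" for s
    using powr_eq_exp_ln[of 5 "s / 2"] by simp
  thus ?thesis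
    by (auto intro!: holomorphic_intros)
qed

lemma Xi_series_holomorphic: "Xi_series holomorphic_on UNIV"
proof -
  have "(\<lambda>s. \<Sum>k. Xi_term k s) holomorphic_on UNIV"
  proof (rule entire_suminf)
    fix r :: real
    show "\<exists>M. summable M \<and> (\<forall>k s. norm s \<le> r \<longrightarrow> norm (Xi_term k s) \<le> M k)"
      using norm_Xi_term_le[OF _ prod_one_plus_geometric_le] norm_q_F_less_1
            sums_summable[OF Xi_majorant_sums]
      by (intro exI[of _ "\<lambda>k. pochhammer r k / fact k * norm q_F ^ k
           * (golden powr r * exp (golden powr r / (1 - norm q_F)))"]) auto
  qed (rule Xi_term_holomorphic)
  thus ?thesis
    unfolding Xi_series_def by (intro holomorphic_intros powr_5_holomorphic)
qed

lemma Xi_series_at_pole_F: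
  "Xi_series (pole_F k m) =
     q_F powi (- (int k * (int k + 1) div 2)) * qpoch_fin q_F k * qpoch_inf q_F q_F
       * 5 powr (pole_F k m / 2) * ((- pole_F k m) gchoose k)"
proof -
  define a where "a = complex_of_real golden powr (- pole_F k m)"
  have a: "a * q_F ^ k = 1"
    unfolding a_def golden_powr_mult_q_F_eq_1_iff by blast
  \<comment> \<open>The factor of index \<open>k\<close> vanishes here, and it is omitted only from
    the term of index \<open>k\<close>.\<close>
  have "Xi_term j (pole_F k m) = 0" if "j \<noteq> k" for j
    using qpoch_omit_eq_0[OF norm_q_F_less_1 a that[symmetric]] by (simp add: Xi_term_def a_def)
  hence "(\<Sum>j. Xi_term j (pole_F k m)) = (\<Sum>j\<in>{k}. Xi_term j (pole_F k m))"
    by (intro suminf_finite) auto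
  also have "\<dots> = ((- pole_F k m) gchoose k) * (-1) ^ k * qpoch_omit k a q_F"
    using a by (simp add: Xi_term_def a_def)
  also have "\<dots> = ((- pole_F k m) gchoose k) * ((-1) ^ k * (-1) ^ k)
       * (q_F powi (- (int k * (int k + 1) div 2)) * qpoch_fin q_F k * qpoch_inf q_F q_F)"
    unfolding qpoch_omit_at_zero[OF a] by (simp only: mult_ac)
  \<comment> \<open>The sign of the series cancels the sign from the \<open>k\<close> factors
    \<open>1 - q^(-i)\<close>.\<close>
  also have "(-1) ^ k * (-1) ^ k = (1::complex)"
    by (simp add: power_mult_distrib[symmetric])
  finally show ?thesis
    by (simp add: Xi_series_def mult_ac)
qed

text \<open>The real part of \<open>- pole_F k m\<close> is \<open>2 * k\<close>, so none of the
  numerator factors \<open>- pole_F k m - i\<close> with \<open>i < k\<close> can vanish.\<close>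

lemma gbinomial_uminus_pole_F_nonzero: "((- pole_F k m) gchoose k) \<noteq> 0"
proof -
  have "- pole_F k m \<noteq> of_nat i" if "i < k" for i
    using that by (auto simp: complex_eq_iff)
  thus ?thesis
    by (auto simp: gbinomial_prod_rev)
qed

lemma Xi_series_at_pole_F_nonzero: "Xi_series (pole_F k m) \<noteq> 0"
proof -
  have "q_F \<noteq> 0"
    using norm_q_F golden_pos by auto
  thus ?thesis
    by (simp add: Xi_series_at_pole_F qpoch_fin_nonzero qpoch_inf_self_nonzero norm_q_F_less_1
          gbinomial_uminus_pole_F_nonzero)
qed

section \<open>The meromorphic continuation\<close>

lemma Xi_term_eq:
  assumes "P_F s \<noteq> 0"
  defines "w \<equiv> \<lambda>k. of_real golden powr (- s) * q_F ^ k"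
  shows "Xi_term k s = P_F s * (((- s) gchoose k) * (-1) ^ k * (w k / (1 - w k)))"
proof -
  have "P_F s = (1 - w k) * qpoch_omit k (of_real golden powr (- s)) q_F"
    unfolding P_F_def w_def by (rule qpoch_inf_eq_omit[OF norm_q_F_less_1])
  thus ?thesis
    using assms(1) by (simp add: Xi_term_def w_def)
qed

text \<open>Binet's formula in the form \<open>F_n = phi^n (1 - q^n) / sqrt 5\<close>, since the
  conjugate root is \<open>phi q\<close>. All factors are positive reals, so the complex power
  splits without branch problems.\<close>

lemma fib_powr_eq:
  "of_nat (fib (Suc n)) powr (- s :: complex) =
     5 powr (s / 2) * (of_real golden powr (- s)) ^ Suc n * (1 - q_F ^ Suc n) powr (- s)"
proof -
  define Q where "Q = - 1 / golden ^ 2"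
  have "(1 - sqrt 5) / 2 = golden * Q"
    using golden_pos by (simp add: Q_def power2_eq_square field_simps) (simp add: golden_def field_simps)
  hence "real (fib (Suc n)) = (golden ^ Suc n - (golden * Q) ^ Suc n) / sqrt 5"
    using fib_closed_form[of "Suc n", folded golden_def] by (simp only:)
  hence fib: "real (fib (Suc n)) = golden ^ Suc n * (1 - Q ^ Suc n) / sqrt 5"
    by (simp add: power_mult_distrib algebra_simps)
  have "\<bar>Q\<bar> < 1"
    using norm_q_F_less_1 by (simp add: q_F_eq_of_real Q_def norm_divide norm_power)
  hence "\<bar>Q ^ Suc n\<bar> < 1"
    unfolding power_abs by (subst power_less_one_iff) auto
  hence Q1: "1 - Q ^ Suc n > 0" by linarith
  have lnfib: "ln (real (fib (Suc n))) = real (Suc n) * ln golden + ln (1 - Q ^ Suc n) - ln 5 / 2"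
    unfolding fib using golden_pos Q1
    by (simp add: ln_div ln_mult ln_realpow ln_sqrt del: power_Suc)
  have "of_nat (fib (Suc n)) powr (- s :: complex) = exp (- s * of_real (ln (real (fib (Suc n)))))"
    using powr_eq_exp_ln[of "real (fib (Suc n))" "- s"] by (simp add: fib_neq_0_nat del: fib.simps)
  also have "\<dots> = exp (s / 2 * of_real (ln 5)) * exp (of_nat (Suc n) * (- s * of_real (ln golden)))
       * exp (- s * of_real (ln (1 - Q ^ Suc n)))"
    unfolding lnfib exp_add[symmetric] by (simp add: algebra_simps)
  also have "exp (s / 2 * of_real (ln 5)) = 5 powr (s / 2)"
    using powr_eq_exp_ln[of 5 "s / 2"] by simp
  also have "exp (of_nat (Suc n) * (- s * of_real (ln golden))) = (of_real golden powr (- s)) ^ Suc n"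
    unfolding exp_of_nat_mult powr_eq_exp_ln[OF golden_pos] ..
  also have "exp (- s * of_real (ln (1 - Q ^ Suc n))) = (1 - q_F ^ Suc n) powr (- s)"
    using powr_eq_exp_ln[OF Q1, of "- s"] by (simp add: q_F_eq_of_real Q_def)
  finally show ?thesis .
qed

text \<open>For \<open>Re s > 0\<close> one has \<open>|phi^(-s)| < 1\<close>. Expanding
  \<open>(1 - q^n)^(-s)\<close> binomially gives a double series; summing over \<open>n\<close>
  first yields geometric series, and hence the terms of \<open>Xi_series\<close> divided by
  \<open>P_F s\<close>.\<close>

lemma fib_zeta_eq:
  assumes "Re s > 0"
  shows "Xi_series s / P_F s = (\<Sum>n. of_nat (fib (Suc n)) powr (- s))"
proof -
  define a where "a = complex_of_real golden powr (- s)"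
  define w where "w k = a * q_F ^ k" for k
  define c where "c k = ((- s) gchoose k) * (-1) ^ k" for k
  have "s \<noteq> pole_F k m" for k m
    using assms by (auto simp: complex_eq_iff)
  hence P: "P_F s \<noteq> 0"
    by (auto simp: P_F_eq_0_iff)
  have "norm a = golden powr (- Re s)"
    using golden_pos by (simp add: a_def norm_powr_real_powr)
  also have "\<dots> < golden powr 0"
    using golden_gt_1 assms by (intro powr_less_mono) auto
  finally have a: "norm a < 1"
    using golden_pos by simp
  have q: "norm q_F ^ k \<le> 1" for k
    using norm_q_F_less_1 by (intro power_le_one) auto
  have w_le: "norm (w k) \<le> norm a" for k
    using mult_left_mono[OF q[of k], of "norm a"] by (simp add: w_def norm_mult norm_power)
  have w: "norm (w k) < 1" for k
    using w_le[of k] a by linarith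
  have geo: "(\<Sum>n. c k * w k ^ Suc n) = c k * (w k / (1 - w k))" for k
  proof -
    have "(\<lambda>n. c k * w k * w k ^ n) sums (c k * w k * (1 / (1 - w k)))"
      by (intro sums_mult geometric_sums w)
    thus ?thesis
      by (simp add: sums_iff mult_ac)
  qed
  have bin: "(\<Sum>k. c k * w k ^ Suc n) = a ^ Suc n * (1 - q_F ^ Suc n) powr (- s)" for n
  proof -
    have "norm (q_F ^ Suc n) < 1"
      unfolding norm_power using norm_q_F_less_1
      by (subst power_less_one_iff) auto
    hence "(\<lambda>k. ((- s) gchoose k) * (- (q_F ^ Suc n)) ^ k) sums (1 + - (q_F ^ Suc n)) powr (- s)"
      by (intro gen_binomial_complex) (simp del: power_Suc)
    hence "(\<lambda>k. a ^ Suc n * (((- s) gchoose k) * (- (q_F ^ Suc n)) ^ k)) sums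
              (a ^ Suc n * (1 + - (q_F ^ Suc n)) powr (- s))"
      by (rule sums_mult)
    moreover have "a ^ Suc n * (((- s) gchoose k) * (- (q_F ^ Suc n)) ^ k) = c k * w k ^ Suc n" for k
      unfolding c_def w_def power_mult_distrib power_minus[of "q_F ^ Suc n"]
      by (simp add: power_mult[symmetric] mult_ac del: power_Suc)
    ultimately show ?thesis
      by (simp add: sums_iff)
  qed
  have "(\<lambda>n. \<Sum>k. c k * w k ^ Suc n) sums (\<Sum>k. \<Sum>n. c k * w k ^ Suc n)"
  proof (rule sums_swap_dominated)
    fix k n
    \<comment> \<open>Discarding \<open>|q|^(k n) <= 1\<close> decouples the two indices, as a
      product majorant demands.\<close>
    have "norm (w k) ^ Suc n = norm a ^ Suc n * norm q_F ^ k * (norm q_F ^ k) ^ n"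
      by (simp add: w_def norm_mult norm_power power_mult_distrib)
    also have "\<dots> \<le> norm a ^ Suc n * norm q_F ^ k * 1"
      using power_le_one[OF _ q[of k], of n] by (intro mult_left_mono) auto
    finally have "norm (w k) ^ Suc n \<le> norm q_F ^ k * norm a ^ Suc n"
      by (simp add: mult_ac)
    moreover have "norm (c k) \<le> pochhammer (norm s) k / fact k"
      using norm_gbinomial_uminus_le[OF order.refl, of s k] by (simp add: c_def norm_mult norm_power)
    ultimately have "norm (c k) * norm (w k) ^ Suc n
        \<le> pochhammer (norm s) k / fact k * (norm q_F ^ k * norm a ^ Suc n)"
      by (intro mult_mono order.trans[OF norm_ge_zero \<open>norm (c k) \<le> _\<close>]) auto
    thus "norm (c k * w k ^ Suc n) \<le> (pochhammer (norm s) k / fact k * norm q_F ^ k) * norm a ^ Suc n"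
      by (simp add: norm_mult norm_power mult_ac)
    show "summable (\<lambda>k. pochhammer (norm s) k / fact k * norm q_F ^ k)"
      using norm_q_F_less_1 by (intro sums_summable[OF sums_pochhammer]) auto
    show "0 \<le> pochhammer (norm s) k / fact k * norm q_F ^ k"
      by (intro mult_nonneg_nonneg divide_nonneg_nonneg)
         (auto simp: pochhammer_prod intro!: prod_nonneg)
    show "summable (\<lambda>n. norm a ^ Suc n)"
      using a by (subst summable_Suc_iff) (auto intro: summable_geometric)
  qed auto
  hence "(\<lambda>n. 5 powr (s / 2) * (a ^ Suc n * (1 - q_F ^ Suc n) powr (- s))) sums
           (5 powr (s / 2) * (\<Sum>k. c k * (w k / (1 - w k))))"
    unfolding geo bin by (rule sums_mult)
  hence sums: "(\<lambda>n. of_nat (fib (Suc n)) powr (- s)) sums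
           (5 powr (s / 2) * (\<Sum>k. c k * (w k / (1 - w k))))"
    by (simp only: fib_powr_eq a_def mult.assoc)
  \<comment> \<open>Summability is inherited from \<open>Xi_term\<close>, so that
    \<open>P_F s\<close> can be pulled out of the sum.\<close>
  have "summable (\<lambda>k. Xi_term k s / P_F s)"
    by (intro summable_divide summable_norm_cancel[OF summable_norm_Xi_term])
  hence "summable (\<lambda>k. c k * (w k / (1 - w k)))"
    using Xi_term_eq[OF P] P by (simp add: c_def w_def a_def)
  hence "(\<Sum>k. P_F s * (c k * (w k / (1 - w k)))) = P_F s * (\<Sum>k. c k * (w k / (1 - w k)))"
    by (rule suminf_mult)
  hence "Xi_series s / P_F s = 5 powr (s / 2) * (\<Sum>k. c k * (w k / (1 - w k)))"
    using Xi_term_eq[OF P] P by (simp add: Xi_series_def c_def w_def a_def)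
  thus ?thesis
    using sums by (simp add: sums_iff)
qed

text \<open>All zeros of the entire function \<open>P_F\<close> have real part at most
  \<open>0\<close>, so \<open>P_F 1\<close> is nonzero and the zeros are isolated.\<close>

lemma eventually_P_F_nonzero: "eventually (\<lambda>s. P_F s \<noteq> 0) (at z)"
proof -
  have "1 \<noteq> pole_F k m" for k m
    by (simp add: complex_eq_iff)
  hence "P_F 1 \<noteq> 0"
    by (simp add: P_F_eq_0_iff)
  hence "eventually (\<lambda>s. P_F s \<noteq> 0 \<and> s \<in> UNIV) (at z)"
    by (intro non_zero_neighbour_alt[OF P_F_holomorphic]) auto
  thus ?thesis by simp
qed

text \<open>At \<open>z\<close> only the factor \<open>1 - a q^k\<close> vanishes, so the derivative
  of \<open>P_F\<close> there is \<open>ln golden\<close> times the product of the other factors,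
  which \<open>qpoch_omit_at_zero\<close> shows to be nonzero.\<close>

lemma zorder_P_F:
  assumes "P_F z = 0"
  shows "zorder P_F z = 1"
proof -
  from assms obtain k m where z: "z = pole_F k m"
    by (auto simp: P_F_eq_0_iff)
  define a where "a s = complex_of_real golden powr (- s)" for s
  define G where "G s = qpoch_omit k (a s) q_F" for s
  have a: "a z * q_F ^ k = 1"
    unfolding a_def golden_powr_mult_q_F_eq_1_iff using z by blast
  have "(\<lambda>x. qpoch_omit k x q_F) \<circ> a holomorphic_on UNIV"
    unfolding a_def by (rule holomorphic_on_compose_gen[OF golden_powr_holomorphic
          qpoch_omit_holomorphic[OF norm_q_F_less_1]]) auto
  hence "G holomorphic_on UNIV"
    by (simp add: G_def[abs_def] o_def)
  then obtain G' where G': "(G has_field_derivative G') (at z)"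
    using holomorphic_on_imp_differentiable_at[of G UNIV z] by (auto simp: field_differentiable_def)
  have eq: "P_F s = (1 - a s * q_F ^ k) * G s" for s
    unfolding P_F_def a_def G_def by (rule qpoch_inf_eq_omit[OF norm_q_F_less_1])
  have "G z \<noteq> 0"
  proof -
    have "q_F \<noteq> 0"
      using norm_q_F golden_pos by auto
    thus ?thesis
      unfolding G_def qpoch_omit_at_zero[OF a]
      by (simp add: qpoch_fin_nonzero qpoch_inf_self_nonzero norm_q_F_less_1)
  qed
  have "(a has_field_derivative (- of_real (ln golden) * a z)) (at z)"
    unfolding a_def powr_eq_exp_ln[OF golden_pos] by (auto intro!: derivative_eq_intros)
  hence "((\<lambda>s. (1 - a s * q_F ^ k) * G s) has_field_derivative
           (1 - a z * q_F ^ k) * G' + of_real (ln golden) * (a z * q_F ^ k) * G z) (at z)"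
    using G' by (auto intro!: derivative_eq_intros)
  hence "deriv P_F z = of_real (ln golden) * G z"
    unfolding eq[abs_def, symmetric] a by (intro DERIV_imp_deriv) simp
  also have "\<dots> \<noteq> 0"
    using ln_golden_pos \<open>G z \<noteq> 0\<close> by simp
  finally show ?thesis
    using assms by (intro zorder_zero_eqI[OF P_F_holomorphic]) auto
qed

text \<open>The quotient is nicely meromorphic: at a zero of \<open>P_F\<close> the numerator is
  nonzero, so there is a pole, and division by zero gives the required value \<open>0\<close>. It
  agrees with the Dirichlet series for \<open>Re s > 0\<close>, so uniqueness of the continuation
  identifies it with \<open>Z_F\<close>.\<close>

lemma Z_F_eq: "Z_F s = Xi_series s / P_F s"
  and is_pole_Z_F_iff: "is_pole Z_F s \<longleftrightarrow> P_F s = 0"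
proof -
  define Z where "Z s = Xi_series s / P_F s" for s
  have cont: "isCont Xi_series s" "isCont P_F s" for s
    using Xi_series_holomorphic P_F_holomorphic
    by (auto intro!: continuous_on_interior[of UNIV] holomorphic_on_imp_continuous_on)
  have pole: "is_pole Z s" if "P_F s = 0" for s
    unfolding Z_def
  proof (rule is_pole_divide)
    show "filterlim P_F (at 0) (at s)"
      using cont(2)[of s] that eventually_P_F_nonzero[of s]
      by (simp add: filterlim_at isCont_def)
    show "Xi_series s \<noteq> 0"
      using that Xi_series_at_pole_F_nonzero by (auto simp: P_F_eq_0_iff)
  qed (rule cont)
  have lim: "Z \<midarrow>s\<rightarrow> Z s" if "P_F s \<noteq> 0" for s
    unfolding Z_def using that cont[of s] by (auto intro!: tendsto_intros simp: isCont_def)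
  have nice: "Z nicely_meromorphic_on UNIV"
    unfolding nicely_meromorphic_on_def
  proof (intro conjI ballI)
    show "Z meromorphic_on UNIV"
      unfolding Z_def[abs_def]
      by (intro meromorphic_intros analytic_on_imp_meromorphic_on)
         (auto simp: analytic_on_open Xi_series_holomorphic P_F_holomorphic)
  next
    fix s show "is_pole Z s \<and> Z s = 0 \<or> Z \<midarrow>s\<rightarrow> Z s"
      using pole[of s] lim[of s] by (cases "P_F s = 0") (auto simp: Z_def)
  qed
  have "Z_F = Z"
    unfolding Z_F_def
  proof (rule the_equality)
    show "Z nicely_meromorphic_on UNIV \<and> (\<forall>s. 0 < Re s \<longrightarrow> Z s = (\<Sum>n. of_nat (fib (Suc n)) powr - s))"
      using nice fib_zeta_eq by (auto simp: Z_def)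
  next
    fix f assume f: "f nicely_meromorphic_on UNIV \<and> (\<forall>s. 0 < Re s \<longrightarrow> f s = (\<Sum>n. of_nat (fib (Suc n)) powr - s))"
    show "f = Z"
    proof (rule nicely_meromorphic_eqI)
      show "f z = Z z" if "z \<in> {s. Re s > 0}" for z
        using that f fib_zeta_eq by (auto simp: Z_def)
      show "{s. Re s > 0} \<noteq> {}"
        by (auto intro!: exI[of _ 1])
    qed (use f nice in \<open>auto simp: open_halfspace_Re_gt\<close>)
  qed
  thus "Z_F s = Xi_series s / P_F s"
    using Z_def[of s] by simp
  show "is_pole Z_F s \<longleftrightarrow> P_F s = 0"
    using pole[of s] lim[of s] \<open>Z_F = Z\<close>
    by (metis at_neq_bot is_pole_def not_tendsto_and_filterlim_at_infinity)
qed

lemma poles_Z_F: "poles Z_F = {pole_F k m | k m. True}"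
  by (auto simp: poles_def is_pole_Z_F_iff P_F_eq_0_iff)

text \<open>The product agrees with the continuous function \<open>Xi_series\<close> off the
  isolated zeros of \<open>P_F\<close>, so filling in limits returns
  \<open>Xi_series\<close>.\<close>

lemma Xi_F_eq: "Xi_F = Xi_series"
proof
  fix z
  have "eventually (\<lambda>s. Xi_series s = P_F s * Z_F s) (at z)"
    using eventually_P_F_nonzero by eventually_elim (simp add: Z_F_eq)
  moreover have "Xi_series \<midarrow>z\<rightarrow> Xi_series z"
    using Xi_series_holomorphic
    by (auto intro!: continuous_on_interior[of UNIV] holomorphic_on_imp_continuous_on isContD)
  ultimately have "(\<lambda>s. P_F s * Z_F s) \<midarrow>z\<rightarrow> Xi_series z"
    by (rule Lim_transform_eventually[rotated])
  thus "Xi_F z = Xi_series z"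
    unfolding Xi_F_def by (rule remove_sings_eqI)
qed

lemma eventually_Xi_series_nonzero: "eventually (\<lambda>s. Xi_series s \<noteq> 0) (at z)"
proof -
  have "eventually (\<lambda>s. Xi_series s \<noteq> 0 \<and> s \<in> UNIV) (at z)"
    by (intro non_zero_neighbour_alt[OF Xi_series_holomorphic, of _ "pole_F 0 0"]
          Xi_series_at_pole_F_nonzero) auto
  thus ?thesis by simp
qed

section \<open>Orders of zeros and poles\<close>

lemma zorder_Z_F: "zorder Z_F s = zorder Xi_series s - zorder P_F s"
proof -
  have "zorder (\<lambda>s. Xi_series s / P_F s) s = zorder Xi_series s - zorder P_F s"
    by (intro zorder_divide eventually_frequently eventually_Xi_series_nonzero eventually_P_F_nonzero
          analytic_on_imp_meromorphic_on holomorphic_on_imp_analytic_at[where A = UNIV]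
          Xi_series_holomorphic P_F_holomorphic) auto
  thus ?thesis
    by (simp add: Z_F_eq[abs_def])
qed

text \<open>The numerator is nonzero and the denominator has a simple zero. Counting poles with
  multiplicity is thus counting points.\<close>

lemma zorder_Z_F_pole:
  assumes "s \<in> poles Z_F"
  shows "zorder Z_F s = - 1"
proof -
  have s: "P_F s = 0" "Xi_series s \<noteq> 0"
    using assms Xi_series_at_pole_F_nonzero by (auto simp: poles_Z_F P_F_eq_0_iff)
  have "zorder Xi_series s = 0"
    using s(2) by (intro zorder_eq_0I holomorphic_on_imp_analytic_at[OF Xi_series_holomorphic]) auto
  thus ?thesis
    using zorder_P_F[OF s(1)] by (simp add: zorder_Z_F)
qed

text \<open>At the zeros of \<open>P_F\<close>, \<open>Z_F\<close> has poles and
  \<open>Xi_series\<close> does not vanish; elsewhere the two differ by a nonzero factor.\<close>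

lemma zeros_Xi_F: "zeros Xi_F = zeros Z_F"
  and zeros_Xi_F_eq: "zeros Xi_F = {s. Xi_series s = 0}"
proof -
  have "\<not> is_pole Xi_series s" for s
    using Xi_series_holomorphic not_is_pole_holomorphic[of UNIV s Xi_series] by auto
  thus "zeros Xi_F = {s. Xi_series s = 0}"
    by (auto simp: zeros_def Xi_F_eq)
  moreover have "Xi_series s \<noteq> 0" if "P_F s = 0" for s
    using that Xi_series_at_pole_F_nonzero by (auto simp: P_F_eq_0_iff)
  ultimately show "zeros Xi_F = zeros Z_F"
    by (auto simp: zeros_def is_pole_Z_F_iff Z_F_eq)
qed

lemma zorder_Xi_F_zero:
  assumes "s \<in> zeros Z_F"
  shows "zorder Xi_F s = zorder Z_F s"
proof -
  have "P_F s \<noteq> 0"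
    using assms by (auto simp: zeros_def is_pole_Z_F_iff)
  hence "zorder P_F s = 0"
    by (intro zorder_eq_0I holomorphic_on_imp_analytic_at[OF P_F_holomorphic]) auto
  thus ?thesis
    by (simp add: zorder_Z_F Xi_F_eq)
qed

lemma finite_zeros_Z_F: "finite (zeros Z_F \<inter> cball 0 R)"
proof -
  have "finite {z \<in> cball 0 R. Xi_series z = 0}"
  \<comment> \<open>Isolation of zeros presupposes a nonconstant function; a constant one would be
    nonzero by its value at \<open>pole_F 0 0\<close>.\<close>
  proof (cases "Xi_series constant_on UNIV")
    case True
    then obtain c where c: "\<And>z. Xi_series z = c"
      unfolding constant_on_def by blast
    hence "c \<noteq> 0"
      using Xi_series_at_pole_F_nonzero[of 0 0] by simp
    thus ?thesis
      by (simp add: c)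
  next
    case False
    show ?thesis
      by (rule holomorphic_compact_finite_zeros[OF Xi_series_holomorphic _ _ _ _ False]) auto
  qed
  moreover have "zeros Z_F \<inter> cball 0 R = {z \<in> cball 0 R. Xi_series z = 0}"
    using zeros_Xi_F zeros_Xi_F_eq by auto
  ultimately show ?thesis by simp
qed

section \<open>Growth\<close>

lemma norm_q_F_power: "golden powr r * norm q_F ^ j = exp (ln golden * (r - 2 * real j))"
proof -
  have "norm q_F ^ j = exp (- (2 * ln golden) * real j)"
    unfolding q_F_power_eq_exp norm_power[symmetric] by (simp add: mult_ac)
  thus ?thesis
    using golden_pos by (simp add: powr_def exp_add[symmetric] algebra_simps)
qed

text \<open>
  The factors with \<open>2 j < r\<close> contribute \<open>\<Sum>(r - 2 j) \<le> r\<^sup>2 / 4 + O(r)\<close> to the exponent, the others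
  only a bounded amount.
\<close>
lemma prod_golden_le:
  fixes r :: real
  assumes "r \<ge> 0"
  shows "(\<Prod>j<n. 1 + golden powr r * norm q_F ^ j) \<le>
           exp (ln golden * r\<^sup>2 / 4 + (ln 2 + ln golden) * (r / 2 + 1) + 1 / (1 - norm q_F))"
proof -
  define L where "L = ln golden"
  \<comment> \<open>\<open>N\<close> marks where the exponent \<open>r - 2 j\<close> stops being
    positive.\<close>
  define N where "N = nat \<lceil>r / 2\<rceil>"
  have L: "L > 0" using ln_golden_pos by (simp add: L_def)
  have N: "r / 2 \<le> real N" "real N \<le> r / 2 + 1"
    using assms by (auto simp: N_def)
  define f where "f j = 1 + golden powr r * norm q_F ^ j" for j
  have f1: "1 \<le> f j" for j
    by (simp add: f_def)
  \<comment> \<open>The extra factors are at least \<open>1\<close>; they make the head of length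
    \<open>N\<close> complete even if \<open>n < N\<close>.\<close>
  have "(\<Prod>j<n. f j) \<le> (\<Prod>j<N + n. f j)"
    using f1 by (intro prod_mono2) (auto intro: order.trans[OF zero_le_one])
  also have "\<dots> = (\<Prod>j<N. f j) * (\<Prod>j<n. f (N + j))"
    by (induction n) (auto simp: mult_ac)
  also have "\<dots> \<le> (2 ^ N * exp (L * (r\<^sup>2 / 4 + real N))) * exp (1 / (1 - norm q_F))"
  proof (rule mult_mono)
    have "(\<Prod>j<N. f j) \<le> (\<Prod>j<N. 2 * exp (L * (r - 2 * real j)))"
    proof (intro prod_mono conjI)
      fix j assume "j \<in> {..<N}"
      hence "real j < r / 2"
        by (simp add: N_def) linarith
      hence "0 \<le> L * (r - 2 * real j)"
        using L by simp
      hence "1 \<le> exp (L * (r - 2 * real j))"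
        by simp
      thus "f j \<le> 2 * exp (L * (r - 2 * real j))"
        by (simp add: f_def norm_q_F_power L_def)
      show "0 \<le> f j" using f1[of j] by linarith
    qed
    also have "\<dots> = 2 ^ N * exp (L * (\<Sum>j<N. r - 2 * real j))"
      by (simp add: prod.distrib exp_sum sum_distrib_left)
    also have "(\<Sum>j<N. r - 2 * real j) = r * real N - real N * (real N - 1)"
      by (induction N) (auto simp: algebra_simps)
    \<comment> \<open>The left side is \<open>r^2 / 4 - (r / 2 - N)^2 + N\<close>.\<close>
    also have "\<dots> \<le> r\<^sup>2 / 4 + real N"
      using zero_le_power2[of "r / 2 - real N"] by (simp add: power2_eq_square algebra_simps)
    finally show "(\<Prod>j<N. f j) \<le> 2 ^ N * exp (L * (r\<^sup>2 / 4 + real N))"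
      using L by simp
  next
    \<comment> \<open>The tail is again a product of the same kind, with amplitude
      \<open>A <= 1\<close> because \<open>r <= 2 * N\<close>.\<close>
    define A where "A = golden powr r * norm q_F ^ N"
    have A: "0 \<le> A" "A \<le> 1"
      using L N by (auto simp: A_def norm_q_F_power L_def[symmetric] mult_nonneg_nonpos)
    have "(\<Prod>j<n. f (N + j)) = (\<Prod>j<n. 1 + A * norm q_F ^ j)"
      by (simp add: f_def A_def power_add mult_ac)
    also have "\<dots> \<le> exp (A / (1 - norm q_F))"
      using A norm_q_F_less_1 by (intro prod_one_plus_geometric_le) auto
    also have "\<dots> \<le> exp (1 / (1 - norm q_F))"
      using A norm_q_F_less_1 by (simp add: divide_right_mono)
    finally show "(\<Prod>j<n. f (N + j)) \<le> exp (1 / (1 - norm q_F))" .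
  next
    show "0 \<le> (\<Prod>j<n. f (N + j))"
      using f1 by (intro prod_nonneg) (auto intro: order.trans[OF zero_le_one])
  qed auto
  also have "\<dots> = exp (L * r\<^sup>2 / 4 + (ln 2 + L) * real N + 1 / (1 - norm q_F))"
    by (simp add: exp_add[symmetric] algebra_simps exp_of_nat_mult)
       (simp add: exp_add exp_of_nat_mult mult_ac)
  also have "\<dots> \<le> exp (L * r\<^sup>2 / 4 + (ln 2 + L) * (r / 2 + 1) + 1 / (1 - norm q_F))"
    using N L by (simp add: mult_left_mono)
  finally show ?thesis
    by (simp add: f_def L_def)
qed

text \<open>Only the product estimate contributes to the exponent at order \<open>r^2\<close>; the
  remaining factors are exponential in \<open>r\<close>.\<close>

lemma Xi_series_upper:
  obtains C where "C \<ge> 0"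
    "\<And>r s. norm s \<le> r \<Longrightarrow> norm (Xi_series s) \<le> exp (ln golden * r\<^sup>2 / 4 + C * (r + 1))"
proof -
  define x where "x = norm q_F"
  have x: "0 \<le> x" "x < 1"
    using norm_q_F_less_1 by (auto simp: x_def)
  \<comment> \<open>Linear contributions in turn: \<open>5 powr (s / 2)\<close>, the binomial
    series, the factor \<open>phi^(-s)\<close> of each term, and the linear part of
    \<open>prod_golden_le\<close>.\<close>
  define c1 where "c1 = ln 5 / 2 - ln (1 - x) + ln golden + (ln 2 + ln golden) / 2"
  define c2 where "c2 = (ln 2 + ln golden) + 1 / (1 - x)"
  have "ln (1 - x) \<le> 0" "1 / (1 - x) \<ge> 0" "ln 5 \<ge> (0::real)" "ln 2 \<ge> (0::real)"
    using x by auto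
  note * = this ln_golden_pos
  have "0 \<le> a / 2 - b + c + (d + c) / 2" if "b \<le> 0" "0 \<le> a" "0 \<le> d" "0 < c" for a b c d :: real
    using that by simp
  hence c1: "c1 \<ge> 0"
    unfolding c1_def using * by blast
  have c2: "c2 \<ge> 0"
    unfolding c2_def using * by linarith
  note c = c1 c2
  show ?thesis
  proof (rule that[of "c1 + c2"])
    fix r and s :: complex assume s: "norm s \<le> r"
    hence r: "r \<ge> 0"
      using norm_ge_zero[of s] by linarith
    define K where "K = exp (ln golden * r\<^sup>2 / 4 + (ln 2 + ln golden) * (r / 2 + 1) + 1 / (1 - x))"
    have le: "norm (Xi_term k s) \<le> pochhammer r k / fact k * x ^ k * (golden powr r * K)" for k
      unfolding x_def by (rule norm_Xi_term_le[OF s]) (use prod_golden_le[OF r] in \<open>auto simp: K_def x_def\<close>)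
    have maj: "(\<lambda>k. pochhammer r k / fact k * x ^ k * (golden powr r * K)) sums
           ((1 - x) powr (- r) * (golden powr r * K))"
      unfolding x_def by (rule Xi_majorant_sums)
    have "norm (\<Sum>k. Xi_term k s) \<le> (\<Sum>k. norm (Xi_term k s))"
      by (rule summable_norm[OF summable_norm_Xi_term])
    also have "\<dots> \<le> (\<Sum>k. pochhammer r k / fact k * x ^ k * (golden powr r * K))"
      by (rule suminf_le[OF le summable_norm_Xi_term sums_summable[OF maj]])
    also have "\<dots> = (1 - x) powr (- r) * (golden powr r * K)"
      using maj by (simp add: sums_iff)
    finally have 1: "norm (\<Sum>k. Xi_term k s) \<le> (1 - x) powr (- r) * (golden powr r * K)" .
    have "norm (5 powr (s / 2) :: complex) = 5 powr (Re s / 2)"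
      using norm_powr_real_powr[of 5 "s / 2"] by simp
    also have "\<dots> \<le> 5 powr (r / 2)"
      using s abs_Re_le_cmod[of s] by (intro powr_mono) auto
    finally have "norm (Xi_series s) \<le> 5 powr (r / 2) * ((1 - x) powr (- r) * (golden powr r * K))"
      unfolding Xi_series_def norm_mult using 1 by (intro mult_mono) auto
    also have "\<dots> = exp (ln golden * r\<^sup>2 / 4 + (c1 * r + c2))"
      using x golden_pos
      by (simp add: powr_def K_def exp_add[symmetric]) (simp add: c1_def c2_def field_simps)
    also have "c1 * r + c2 \<le> (c1 + c2) * (r + 1)"
      using c r by (simp add: algebra_simps)
    finally show "norm (Xi_series s) \<le> exp (ln golden * r\<^sup>2 / 4 + (c1 + c2) * (r + 1))"
      by simp
  qed (use c in auto)
qed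

text \<open>At the real poles \<open>-4 j\<close> the exact value of \<open>Xi_series\<close> is
  known, and its modulus is governed by the power of \<open>q\<close>; the other factors cost at
  most an exponential in \<open>j\<close>.\<close>

lemma Xi_series_lower:
  obtains C where "C \<ge> 0"
    "\<And>j. norm (Xi_series (- 4 * of_nat j)) \<ge> exp (ln golden * (4 * real j)\<^sup>2 / 4 - C * (4 * real j + 1))"
proof -
  \<comment> \<open>The nonzero limit of \<open>(q;q)_k\<close> yields a lower bound independent of
    \<open>k\<close>.\<close>
  have "(\<lambda>k. inverse (qpoch_fin q_F k)) \<longlonglongrightarrow> inverse (qpoch_inf q_F q_F)"
    by (intro tendsto_inverse qpoch_fin_LIMSEQ qpoch_inf_self_nonzero norm_q_F_less_1)
  hence "Bseq (\<lambda>k. inverse (qpoch_fin q_F k))"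
    by (intro convergent_imp_Bseq convergentI)
  then obtain B where B: "B > 0" "\<And>k. norm (inverse (qpoch_fin q_F k)) \<le> B"
    by (auto elim: BseqE)
  define d where "d = norm (qpoch_inf q_F q_F) / B"
  have d: "d > 0"
    using B qpoch_inf_self_nonzero[OF norm_q_F_less_1] by (simp add: d_def)
  show ?thesis
  proof (rule that[of "\<bar>ln d\<bar> + ln 5"])
    fix j :: nat
    define k where "k = 2 * j"
    \<comment> \<open>With \<open>k = 2 j\<close> and \<open>m = -j\<close> the factor
      \<open>2 m + k\<close> vanishes, so the pole is real.\<close>
    define p where "p = pole_F k (- int j)"
    have p: "p = - 4 * of_nat j"
      by (simp add: p_def k_def pole_F_def)
    have "d \<le> norm (qpoch_fin q_F k * qpoch_inf q_F q_F)"
    proof -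
      have "1 / B \<le> norm (qpoch_fin q_F k)"
        using B(1) B(2)[of k] qpoch_fin_nonzero[OF norm_q_F_less_1, of k]
        by (simp add: norm_divide field_simps)
      thus ?thesis
        using mult_right_mono[of "1 / B" "norm (qpoch_fin q_F k)" "norm (qpoch_inf q_F q_F)"]
        by (simp add: d_def norm_mult)
    qed
    \<comment> \<open>The modulus is \<open>phi^(k(k+1))\<close>, and
      \<open>k^2 = (4 j)^2 / 4\<close> is the main term.\<close>
    moreover have "norm (q_F powi (- (int k * (int k + 1) div 2))) = exp (ln golden * (real k * (real k + 1)))"
    proof -
      have "int k * (int k + 1) div 2 = int (k * (k + 1) div 2)"
        by (simp add: zdiv_int algebra_simps)
      hence "norm (q_F powi (- (int k * (int k + 1) div 2))) = inverse (norm q_F ^ (k * (k + 1) div 2))"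
        by (simp add: power_int_minus norm_inverse norm_power)
      also have "norm q_F ^ (k * (k + 1) div 2) = exp (- (ln golden * (2 * real (k * (k + 1) div 2))))"
        using norm_q_F_power[of 0 "k * (k + 1) div 2"] golden_pos by simp
      also have "2 * real (k * (k + 1) div 2) = real k * (real k + 1)"
        by (subst real_of_nat_div) (auto simp: algebra_simps)
      finally show ?thesis by (simp add: exp_minus)
    qed
    moreover have "norm (5 powr (p / 2) :: complex) = exp (- ln 5 * real k)"
      using norm_powr_real_powr[of 5 "p / 2"] by (simp add: p k_def powr_def)
    \<comment> \<open>Here \<open>- p = 2 * k\<close>, so this is a central binomial
      coefficient.\<close>
    moreover have "1 \<le> norm ((- p) gchoose k)"
    proof -
      have "(- p) gchoose k = of_nat ((2 * k) choose k)"
        by (simp add: binomial_gbinomial p k_def mult.assoc[symmetric])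
      moreover have "1 \<le> (2 * k) choose k"
        by (simp add: Suc_le_eq)
      ultimately show ?thesis by simp
    qed
    ultimately have "exp (ln golden * (real k * (real k + 1))) * d * exp (- ln 5 * real k) * 1
        \<le> norm (q_F powi (- (int k * (int k + 1) div 2)))
            * norm (qpoch_fin q_F k * qpoch_inf q_F q_F)
            * norm (5 powr (p / 2) :: complex) * norm ((- p) gchoose k)"
      using d by (intro mult_mono) auto
    also have "\<dots> = norm (Xi_series p)"
      unfolding p_def Xi_series_at_pole_F by (simp only: norm_mult mult_ac)
    finally have lower: "exp (ln golden * (real k * (real k + 1))) * d * exp (- ln 5 * real k) \<le> norm (Xi_series p)"
      by simp
    have "exp (ln golden * (4 * real j)\<^sup>2 / 4 - (\<bar>ln d\<bar> + ln 5) * (4 * real j + 1))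
        \<le> exp (ln golden * (real k * (real k + 1)) + ln d - ln 5 * real k)"
    proof (subst exp_le_cancel_iff)
      have "(4 * real j)\<^sup>2 / 4 = real k * real k"
        by (simp add: k_def power2_eq_square)
      hence 1: "ln golden * (4 * real j)\<^sup>2 / 4 = ln golden * (real k * real k)"
        by (metis times_divide_eq_right)
      have 2: "0 \<le> real j * (ln golden * 2)" "0 \<le> real j * (\<bar>ln d\<bar> * 4)" "0 \<le> real j * (2 * ln 5)"
          "0 \<le> (ln 5 :: real)" "0 \<le> ln d + \<bar>ln d\<bar>"
        using ln_golden_pos by auto
      show "ln golden * (4 * real j)\<^sup>2 / 4 - (\<bar>ln d\<bar> + ln 5) * (4 * real j + 1)
        \<le> ln golden * (real k * (real k + 1)) + ln d - ln 5 * real k"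
        unfolding 1 k_def by (simp add: algebra_simps) (use 2 in linarith)
    qed
    also have "\<dots> = exp (ln golden * (real k * (real k + 1))) * d * exp (- ln 5 * real k)"
      using d by (simp add: exp_add exp_diff exp_minus field_simps)
    finally show "norm (Xi_series (- 4 * of_nat j)) \<ge>
        exp (ln golden * (4 * real j)\<^sup>2 / 4 - (\<bar>ln d\<bar> + ln 5) * (4 * real j + 1))"
      using lower unfolding p by (rule order.trans)
  qed auto
qed

text \<open>The lower bound is available only at the points \<open>-4 j\<close>, but one of them
  lies in the disc within distance \<open>4\<close> of the boundary circle, which costs a term
  linear in \<open>r\<close>.\<close>

lemma ln_max_modulus_Xi_F:
  obtains C where "\<And>r. r \<ge> 4 \<Longrightarrow> \<bar>ln (max_modulus Xi_F r) - ln golden / 4 * r\<^sup>2\<bar> \<le> C * r"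
proof -
  obtain C where C: "C \<ge> 0"
    "\<And>r s. norm s \<le> r \<Longrightarrow> norm (Xi_series s) \<le> exp (ln golden * r\<^sup>2 / 4 + C * (r + 1))"
    using Xi_series_upper by blast
  obtain D where D: "D \<ge> 0"
    "\<And>j. norm (Xi_series (- 4 * of_nat j)) \<ge> exp (ln golden * (4 * real j)\<^sup>2 / 4 - D * (4 * real j + 1))"
    using Xi_series_lower by blast
  have upper: "max_modulus Xi_F r \<le> exp (ln golden * r\<^sup>2 / 4 + C * (r + 1))" if "r \<ge> 4" for r
    unfolding max_modulus_def Xi_F_eq
    by (rule cSUP_least) (use C(2)[of _ r] that in auto)
  have lower: "exp (ln golden * (r - 4)\<^sup>2 / 4 - D * (r + 1)) \<le> max_modulus Xi_F r" if r: "r \<ge> 4" for r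
  proof -
    define j where "j = nat \<lfloor>r / 4\<rfloor>"
    have j: "4 * real j \<le> r" "r - 4 \<le> 4 * real j"
      using r by (auto simp: j_def) linarith+
    have "ln golden * (r - 4)\<^sup>2 / 4 \<le> ln golden * (4 * real j)\<^sup>2 / 4"
      using j r ln_golden_pos by (intro divide_right_mono mult_left_mono power_mono) auto
    moreover have "D * (4 * real j + 1) \<le> D * (r + 1)"
      using D(1) j by (intro mult_left_mono) auto
    ultimately have "exp (ln golden * (r - 4)\<^sup>2 / 4 - D * (r + 1))
        \<le> exp (ln golden * (4 * real j)\<^sup>2 / 4 - D * (4 * real j + 1))"
      by simp
    also have "\<dots> \<le> norm (Xi_series (- 4 * of_nat j))"
      by (rule D)
    also have "\<dots> \<le> max_modulus Xi_F r"
      unfolding max_modulus_def Xi_F_eq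
    proof (rule cSUP_upper)
      show "bdd_above ((\<lambda>s. norm (Xi_series s)) ` cball 0 r)"
        using C(2)[of _ r] by (intro bdd_aboveI2) auto
      show "- 4 * of_nat j \<in> cball (0::complex) r"
        using j by (simp add: norm_mult)
    qed
    finally show ?thesis .
  qed
  show ?thesis
  \<comment> \<open>The summand \<open>ln golden\<close> pays for replacing \<open>r - 4\<close> by
    \<open>r\<close>; for \<open>C\<close> and \<open>D\<close> the factor \<open>2\<close> comes
    from \<open>r + 1 <= 2 * r\<close>.\<close>
  proof (rule that[of "2 * (C + D + ln golden)"])
    fix r :: real assume r: "r \<ge> 4"
    have pos: "max_modulus Xi_F r > 0"
      using lower[OF r] by (rule less_le_trans[rotated]) auto
    have "ln (max_modulus Xi_F r) \<le> ln golden * r\<^sup>2 / 4 + C * (r + 1)"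
      using upper[OF r] pos by (metis ln_exp ln_le_cancel_iff exp_gt_zero)
    moreover have "ln golden * (r - 4)\<^sup>2 / 4 - D * (r + 1) \<le> ln (max_modulus Xi_F r)"
      using lower[OF r] pos by (metis ln_exp ln_le_cancel_iff exp_gt_zero)
    moreover have "ln golden * (r - 4)\<^sup>2 / 4 \<ge> ln golden * r\<^sup>2 / 4 - 2 * ln golden * r"
      using ln_golden_pos by (simp add: power2_eq_square algebra_simps)
    moreover have "C * (r + 1) \<le> 2 * C * r" "D * (r + 1) \<le> 2 * D * r"
      using C(1) D(1) r mult_left_mono[of "r + 1" "2 * r" C] mult_left_mono[of "r + 1" "2 * r" D]
      by (auto simp: mult_ac)
    moreover have "0 \<le> C * r" "0 \<le> D * r" "0 \<le> ln golden * r"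
      using C D r ln_golden_pos by auto
    ultimately show "\<bar>ln (max_modulus Xi_F r) - ln golden / 4 * r\<^sup>2\<bar> \<le> 2 * (C + D + ln golden) * r"
      unfolding abs_le_iff by (simp add: algebra_simps)
  qed
qed

section \<open>Order and type\<close>

lemma ln_max_modulus_Xi_F_tendsto:
  "((\<lambda>r. ln (max_modulus Xi_F r) / r\<^sup>2) \<longlongrightarrow> ln golden / 4) at_top"
proof -
  obtain C where C: "\<And>r. r \<ge> 4 \<Longrightarrow> \<bar>ln (max_modulus Xi_F r) - ln golden / 4 * r\<^sup>2\<bar> \<le> C * r"
    using ln_max_modulus_Xi_F by metis
  have "((\<lambda>r. ln (max_modulus Xi_F r) / r\<^sup>2 - ln golden / 4) \<longlongrightarrow> 0) at_top"
  proof (rule Lim_null_comparison)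
    show "eventually (\<lambda>r. norm (ln (max_modulus Xi_F r) / r\<^sup>2 - ln golden / 4) \<le> C / r) at_top"
      using eventually_ge_at_top[of 4]
    proof eventually_elim
      case (elim r)
      have "ln (max_modulus Xi_F r) / r\<^sup>2 - ln golden / 4 = (ln (max_modulus Xi_F r) - ln golden / 4 * r\<^sup>2) / r\<^sup>2"
        using elim by (simp add: field_simps)
      hence "norm (ln (max_modulus Xi_F r) / r\<^sup>2 - ln golden / 4) \<le> C * r / r\<^sup>2"
        using C[OF elim] by (simp add: divide_right_mono)
      thus ?case
        using elim by (simp add: power2_eq_square)
    qed
    show "((\<lambda>r. C / r) \<longlongrightarrow> 0) at_top"
      by real_asymp
  qed
  thus ?thesis
    by (simp add: LIM_zero_iff)
qed

lemma Limsup_ln_max_modulus_Xi_F: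
  "Limsup at_top (\<lambda>r::real. ereal (ln (max_modulus Xi_F r) / r ^ 2)) = ereal (ln golden / 4)"
  by (intro lim_imp_Limsup tendsto_ereal ln_max_modulus_Xi_F_tendsto) auto

lemma growth_type_Xi_F: "growth_type 2 Xi_F = ereal (ln golden / 4)"
proof -
  have "growth_type 2 Xi_F = Limsup at_top (\<lambda>r::real. ereal (ln (max_modulus Xi_F r) / r ^ 2))"
    unfolding growth_type_def
    by (intro Limsup_eq eventually_mono[OF eventually_gt_at_top[of 0]]) auto
  thus ?thesis
    by (simp add: Limsup_ln_max_modulus_Xi_F)
qed

text \<open>Writing \<open>log M(r) = f r * r^2\<close> with \<open>f\<close> tending to a positive
  limit, the iterated logarithm is \<open>ln (f r) + 2 * ln r\<close>, and \<open>ln (f r)\<close>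
  converges.\<close>

lemma growth_order_Xi_F: "growth_order Xi_F = 2"
proof -
  define f where "f r = ln (max_modulus Xi_F r) / r\<^sup>2" for r
  have f: "(f \<longlongrightarrow> ln golden / 4) at_top"
    unfolding f_def by (rule ln_max_modulus_Xi_F_tendsto)
  have pos: "eventually (\<lambda>r. f r > 0) at_top"
    using order_tendstoD(1)[OF f, of 0] ln_golden_pos by simp
  have "((\<lambda>r. ln (f r) / ln r) \<longlongrightarrow> 0) at_top"
    by (rule tendsto_divide_0[OF tendsto_ln[OF f]])
       (use ln_golden_pos in \<open>auto intro: filterlim_mono[OF ln_at_top at_top_le_at_infinity order.refl]\<close>)
  hence "((\<lambda>r. 2 + ln (f r) / ln r) \<longlongrightarrow> 2 + 0) at_top"
    by (intro tendsto_intros)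
  moreover have "eventually (\<lambda>r. 2 + ln (f r) / ln r = ln (ln (max_modulus Xi_F r)) / ln r) at_top"
    using pos eventually_gt_at_top[of 1]
  proof eventually_elim
    case (elim r)
    have "ln (max_modulus Xi_F r) = f r * r\<^sup>2"
      using elim by (simp add: f_def)
    hence "ln (ln (max_modulus Xi_F r)) = ln (f r) + 2 * ln r"
      using elim by (simp add: ln_mult ln_realpow)
    thus ?case
      using elim by (simp add: field_simps)
  qed
  ultimately have "((\<lambda>r. ln (ln (max_modulus Xi_F r)) / ln r) \<longlongrightarrow> 2) at_top"
    using tendsto_cong by fastforce
  hence "growth_order Xi_F = ereal 2"
    unfolding growth_order_def by (intro lim_imp_Limsup tendsto_ereal) auto
  thus ?thesis by simp
qed

text \<open>Zeros of \<open>Z_F\<close> are zeros of the entire function \<open>Xi_series\<close>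
  with the same orders, so the Jensen-type bound applies, with the growth estimate taken at radius
  \<open>3 * R\<close>.\<close>

lemma zero_count_Z_F_bigo:
  "(\<lambda>R::real. real_of_int (zero_count Z_F R)) \<in> O[at_top](\<lambda>R. R ^ 2)"
proof -
  obtain C where C: "C \<ge> 0"
    "\<And>r s. norm s \<le> r \<Longrightarrow> norm (Xi_series s) \<le> exp (ln golden * r\<^sup>2 / 4 + C * (r + 1))"
    using Xi_series_upper by blast
  define K where "K = - ln (norm (Xi_series 0))"
  have Xi0: "Xi_series 0 \<noteq> 0"
    using Xi_series_at_pole_F_nonzero[of 0 0] by (simp add: pole_F_def)
  have "(\<lambda>R::real. real_of_int (zero_count Z_F R)) \<in> O[at_top](\<lambda>R. ln golden * (3 * R)\<^sup>2 / 4 + C * (3 * R + 1) + K)"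
  proof (rule bigoI[where c = "1 / ln 2"])
    show "eventually (\<lambda>R. norm (real_of_int (zero_count Z_F R)) \<le>
            1 / ln 2 * norm (ln golden * (3 * R)\<^sup>2 / 4 + C * (3 * R + 1) + K)) at_top"
      using eventually_gt_at_top[of 0]
    proof eventually_elim
      case (elim R)
      define S where "S = zeros Z_F \<inter> cball 0 R"
      have S: "finite S" "\<And>s. s \<in> S \<Longrightarrow> norm s \<le> R \<and> Xi_series s = 0"
        using finite_zeros_Z_F zeros_Xi_F zeros_Xi_F_eq by (auto simp: S_def)
      have eq: "zero_count Z_F R = (\<Sum>s\<in>S. zorder Xi_series s)"
        unfolding zero_count_def S_def
        by (intro sum.cong) (auto simp: zorder_Xi_F_zero[symmetric] Xi_F_eq)
      \<comment> \<open>Orders of an entire function are nonnegative, so the one-sided bound also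
        bounds the absolute value.\<close>
      have "(\<Sum>s\<in>S. zorder Xi_series s) \<ge> 0"
      proof (intro sum_nonneg)
        fix s
        show "zorder Xi_series s \<ge> 0"
          by (intro zorder_ge_0 holomorphic_on_imp_analytic_at[OF Xi_series_holomorphic]
                eventually_frequently eventually_Xi_series_nonzero) auto
      qed
      hence nonneg: "0 \<le> real_of_int (zero_count Z_F R) * ln 2"
        unfolding eq by (intro mult_nonneg_nonneg) (simp_all only: of_int_0_le_iff, simp)
      have "real_of_int (\<Sum>s\<in>S. zorder Xi_series s) * ln 2 \<le>
              ln (exp (ln golden * (3 * R)\<^sup>2 / 4 + C * (3 * R + 1)) / norm (Xi_series 0))"
        by (rule entire_zero_count_le[OF Xi_series_holomorphic Xi0 \<open>R > 0\<close> C(2) S]) auto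
      hence "real_of_int (zero_count Z_F R) * ln 2 \<le> ln golden * (3 * R)\<^sup>2 / 4 + C * (3 * R + 1) + K"
        using Xi0 by (simp add: eq ln_div K_def)
      with nonneg have "\<bar>real_of_int (zero_count Z_F R)\<bar> * ln 2 \<le> \<bar>ln golden * (3 * R)\<^sup>2 / 4 + C * (3 * R + 1) + K\<bar>"
        by (simp add: zero_le_mult_iff)
      thus ?case
        by (simp add: field_simps)
    qed
  qed
  also have "(\<lambda>R. ln golden * (3 * R)\<^sup>2 / 4 + C * (3 * R + 1) + K) \<in> O[at_top](\<lambda>R. R ^ 2)"
    using ln_golden_pos by real_asymp
  finally show ?thesis .
qed

section \<open>Counting the poles\<close>

lemma card_int_interval:
  fixes a b :: real
  assumes "a \<le> b"
  shows "finite {m::int. a \<le> of_int m \<and> of_int m \<le> b}"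
    and "\<bar>real (card {m::int. a \<le> of_int m \<and> of_int m \<le> b}) - (b - a)\<bar> \<le> 1"
proof -
  have eq: "{m::int. a \<le> of_int m \<and> of_int m \<le> b} = {\<lceil>a\<rceil>..\<lfloor>b\<rfloor>}"
    by (auto simp: ceiling_le_iff le_floor_iff)
  show "finite {m::int. a \<le> of_int m \<and> of_int m \<le> b}"
    unfolding eq by simp
  \<comment> \<open>If no integer lies in between, this is \<open>0\<close> and not negative, so
    nothing is truncated in the cardinality.\<close>
  have "0 \<le> \<lfloor>b\<rfloor> - \<lceil>a\<rceil> + 1"
    using assms by linarith
  hence "real (card {\<lceil>a\<rceil>..\<lfloor>b\<rfloor>}) = of_int \<lfloor>b\<rfloor> - of_int \<lceil>a\<rceil> + 1"
    by simp
  thus "\<bar>real (card {m::int. a \<le> of_int m \<and> of_int m \<le> b}) - (b - a)\<bar> \<le> 1"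
    unfolding eq by linarith
qed

text \<open>The primitive measures area in a quarter ellipse with semi-axes \<open>R / 2\<close> and
  \<open>R\<close>. The endpoint \<open>2 * x = R\<close> is left out because the root is not
  differentiable there.\<close>

lemma has_real_derivative_quarter_ellipse:
  fixes R x :: real
  assumes "0 \<le> x" "2 * x < R"
  shows "((\<lambda>x. x / 2 * sqrt (R\<^sup>2 - (2 * x)\<^sup>2) + R\<^sup>2 / 4 * arcsin (2 * x / R))
           has_real_derivative sqrt (R\<^sup>2 - (2 * x)\<^sup>2)) (at x)"
proof -
  define w where "w = sqrt (R\<^sup>2 - (2 * x)\<^sup>2)"
  have R: "R > 0"
    using assms by simp
  have "(2 * x)\<^sup>2 < R\<^sup>2"
    using assms by (intro power_strict_mono) auto
  hence pos: "R\<^sup>2 - (2 * x)\<^sup>2 > 0"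
    by simp
  hence w: "w > 0" "w\<^sup>2 = R\<^sup>2 - (2 * x)\<^sup>2"
    by (auto simp: w_def)
  have "1 - (2 * x / R)\<^sup>2 = (R\<^sup>2 - (2 * x)\<^sup>2) / R\<^sup>2"
    using R by (simp add: field_simps)
  hence sq: "sqrt (1 - (2 * x / R)\<^sup>2) = w / R"
    using R by (simp add: w_def real_sqrt_divide)
  have 1: "((\<lambda>x. sqrt (R\<^sup>2 - (2 * x)\<^sup>2)) has_real_derivative - 4 * x / w) (at x)"
    using pos unfolding w_def
    by (auto intro!: derivative_eq_intros simp: field_simps power2_eq_square)
  have 2: "((\<lambda>x. arcsin (2 * x / R)) has_real_derivative inverse (w / R) * (2 / R)) (at x)"
  proof -
    have "((\<lambda>x. arcsin (2 * x / R)) has_real_derivative inverse (sqrt (1 - (2 * x / R)\<^sup>2)) * (2 / R)) (at x)"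
      by (rule DERIV_chain2[OF DERIV_arcsin])
         (use assms R in \<open>auto intro!: derivative_eq_intros simp: field_simps\<close>)
    thus ?thesis by (simp only: sq)
  qed
  have "((\<lambda>x. x / 2) has_real_derivative 1 / 2) (at x)"
    by (auto intro!: derivative_eq_intros)
  from DERIV_add[OF DERIV_mult[OF this 1] DERIV_cmult[OF 2, of "R\<^sup>2 / 4"]]
  have "((\<lambda>x. x / 2 * sqrt (R\<^sup>2 - (2 * x)\<^sup>2) + R\<^sup>2 / 4 * arcsin (2 * x / R))
      has_real_derivative 1 / 2 * w + - 4 * x / w * (x / 2) + R\<^sup>2 / 4 * (inverse (w / R) * (2 / R))) (at x)"
    unfolding w_def .
  also have "1 / 2 * w + - 4 * x / w * (x / 2) + R\<^sup>2 / 4 * (inverse (w / R) * (2 / R))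
        = (R\<^sup>2 - (2 * x)\<^sup>2 + w\<^sup>2) / (2 * w)"
    using w(1) R by (simp add: field_simps power2_eq_square)
  also have "\<dots> = w"
    using w(1) by (simp only: w(2)[symmetric]) (simp add: power2_eq_square)
  finally show ?thesis by (simp add: w_def)
qed

text \<open>The summand decreases in \<open>k\<close>, so the sum differs from the area
  \<open>pi R^2 / 8\<close> of the quarter ellipse by at most its first term
  \<open>R\<close>.\<close>

lemma sum_quarter_ellipse:
  fixes R :: real
  assumes R: "R > 0"
  shows "\<bar>(\<Sum>k\<le>nat \<lfloor>R / 2\<rfloor>. sqrt (R\<^sup>2 - (2 * real k)\<^sup>2)) - pi / 8 * R\<^sup>2\<bar> \<le> R"
proof -
  define g where "g x = sqrt (R\<^sup>2 - (2 * x)\<^sup>2)" for x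
  define G where "G x = x / 2 * sqrt (R\<^sup>2 - (2 * x)\<^sup>2) + R\<^sup>2 / 4 * arcsin (2 * x / R)" for x
  define K where "K = nat \<lfloor>R / 2\<rfloor>"
  have K: "2 * real K \<le> R" "R / 2 - real K \<le> 1"
    using R by (auto simp: K_def) linarith+
  have anti: "g y \<le> g x" if "0 \<le> x" "x \<le> y" for x y
    unfolding g_def using that by (auto intro!: power_mono)
  \<comment> \<open>The integral comparison, by the mean value theorem applied to the primitive
    \<open>G\<close>; at \<open>2 * b = R\<close> continuity is enough.\<close>
  have bounds: "(b - a) * g b \<le> G b - G a \<and> G b - G a \<le> (b - a) * g a"
    if "0 \<le> a" "a \<le> b" "2 * b \<le> R" for a b
  proof (cases "a = b")
    case False
    with that have "a < b" by simp
    have "continuous_on {a..b} G"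
      unfolding G_def using that R by (auto intro!: continuous_intros simp: field_simps)
    moreover have deriv: "(G has_real_derivative g x) (at x)" if "a < x" "x < b" for x
      unfolding G_def g_def using that \<open>0 \<le> a\<close> \<open>2 * b \<le> R\<close>
      by (intro has_real_derivative_quarter_ellipse) auto
    ultimately obtain l z where z: "a < z" "z < b" "(G has_real_derivative l) (at z)"
        "G b - G a = (b - a) * l"
      using MVT[of a b G] \<open>a < b\<close> by (auto simp: real_differentiable_def)
    hence "l = g z"
      using DERIV_unique deriv by blast
    moreover have "g b \<le> g z" "g z \<le> g a"
      using z that by (auto intro!: anti)
    ultimately show ?thesis
      using z(4) \<open>a < b\<close> by (auto intro!: mult_left_mono)
  qed auto
  have "G 0 = 0"
    by (simp add: G_def)
  hence tele: "(\<Sum>k<K. G (real (Suc k)) - G (real k)) = G (real K)"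
    using sum_lessThan_telescope[of "\<lambda>k. G (real k)" K] by (simp only: of_nat_0 diff_zero)
  have GR: "G (R / 2) = pi / 8 * R\<^sup>2"
    using R by (simp add: G_def)
  have "(2 * real K)\<^sup>2 \<le> R\<^sup>2"
    using K by (intro power_mono) auto
  hence gK: "0 \<le> g (real K)" "g 0 = R"
    using R by (auto simp: g_def)
  have *: "real (Suc k) \<le> real K" if "k < K" for k
    using that by simp
  have "G (R / 2) = (\<Sum>k<K. G (real (Suc k)) - G (real k)) + (G (R / 2) - G (real K))"
    unfolding tele by simp
  also have "\<dots> \<le> (\<Sum>k<K. g (real k)) + g (real K)"
  proof (rule add_mono)
    show "(\<Sum>k<K. G (real (Suc k)) - G (real k)) \<le> (\<Sum>k<K. g (real k))"
    proof (rule sum_mono)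
      fix k assume "k \<in> {..<K}"
      hence "2 * real (Suc k) \<le> R"
        using *[of k] K(1) by simp
      thus "G (real (Suc k)) - G (real k) \<le> g (real k)"
        using bounds[of "real k" "real (Suc k)"] by simp
    qed
    \<comment> \<open>The piece beyond the last integer has length at most \<open>1\<close>, so the
      term \<open>g (real K)\<close> covers it.\<close>
    have "G (R / 2) - G (real K) \<le> (R / 2 - real K) * g (real K)"
      using bounds[of "real K" "R / 2"] K by simp
    also have "\<dots> \<le> 1 * g (real K)"
      using K gK by (intro mult_right_mono) auto
    finally show "G (R / 2) - G (real K) \<le> g (real K)" by simp
  qed
  also have "\<dots> = (\<Sum>k\<le>K. g (real k))"
    by (simp add: lessThan_Suc_atMost[symmetric])
  finally have 1: "pi / 8 * R\<^sup>2 \<le> (\<Sum>k\<le>K. g (real k))"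
    by (simp add: GR)
  have "(\<Sum>k\<le>K. g (real k)) = g 0 + (\<Sum>k<K. g (real (Suc k)))"
    by (simp add: lessThan_Suc_atMost[symmetric] sum.lessThan_Suc_shift del: sum.lessThan_Suc)
  also have "(\<Sum>k<K. g (real (Suc k))) \<le> (\<Sum>k<K. G (real (Suc k)) - G (real k))"
  proof (rule sum_mono)
    fix k assume "k \<in> {..<K}"
    hence "2 * real (Suc k) \<le> R"
      using *[of k] K(1) by simp
    thus "g (real (Suc k)) \<le> G (real (Suc k)) - G (real k)"
      using bounds[of "real k" "real (Suc k)"] by simp
  qed
  also have "\<dots> \<le> G (R / 2)"
  proof -
    have "0 \<le> (R / 2 - real K) * g (R / 2)"
      using K by (simp add: g_def)
    thus ?thesis
      unfolding tele using bounds[of "real K" "R / 2"] K by simp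
  qed
  finally have 2: "(\<Sum>k\<le>K. g (real k)) \<le> R + pi / 8 * R\<^sup>2"
    by (simp add: GR gK)
  from 1 2 show ?thesis
    by (simp add: g_def K_def)
qed

lemma pole_F_in_cball_iff:
  assumes "R \<ge> 0"
  shows "pole_F k m \<in> cball 0 R \<longleftrightarrow>
           k \<le> nat \<lfloor>R / 2\<rfloor> \<and> \<bar>2 * of_int m + real k\<bar> \<le> ln golden / pi * sqrt (R\<^sup>2 - (2 * real k)\<^sup>2)"
proof -
  define L where "L = ln golden"
  have L: "L > 0" using ln_golden_pos by (simp add: L_def)
  define u where "u = 2 * of_int m + real k"
  have "pole_F k m \<in> cball 0 R \<longleftrightarrow> (norm (pole_F k m))\<^sup>2 \<le> R\<^sup>2"
    using assms by (simp add: abs_le_square_iff[symmetric])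
  also have "\<dots> \<longleftrightarrow> (u * (pi / L))\<^sup>2 \<le> R\<^sup>2 - (2 * real k)\<^sup>2"
    by (auto simp: cmod_power2 u_def L_def)
  \<comment> \<open>Nonnegativity of the square already forces \<open>2 * k <= R\<close>; stating it
    separately bounds the range of \<open>k\<close>.\<close>
  also have "\<dots> \<longleftrightarrow> 2 * real k \<le> R \<and> \<bar>u * (pi / L)\<bar> \<le> sqrt (R\<^sup>2 - (2 * real k)\<^sup>2)"
  proof -
    have "2 * real k \<le> R \<longleftrightarrow> 0 \<le> R\<^sup>2 - (2 * real k)\<^sup>2"
      using assms abs_le_square_iff[of "2 * real k" R] by simp
    moreover have "\<bar>u * (pi / L)\<bar> \<le> sqrt (R\<^sup>2 - (2 * real k)\<^sup>2) \<longleftrightarrow> (u * (pi / L))\<^sup>2 \<le> R\<^sup>2 - (2 * real k)\<^sup>2"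
      by (metis real_sqrt_abs real_sqrt_le_iff)
    moreover have "0 \<le> (u * (pi / L))\<^sup>2"
      by simp
    ultimately show ?thesis
      by linarith
  qed
  also have "\<bar>u * (pi / L)\<bar> = \<bar>u\<bar> * (pi / L)"
    using L by (simp add: abs_mult)
  also have "2 * real k \<le> R \<longleftrightarrow> k \<le> nat \<lfloor>R / 2\<rfloor>"
    using assms by (simp add: le_nat_floor le_nat_iff le_floor_iff field_simps)
  also have "\<bar>u\<bar> * (pi / L) \<le> sqrt (R\<^sup>2 - (2 * real k)\<^sup>2) \<longleftrightarrow>
               \<bar>u\<bar> \<le> L / pi * sqrt (R\<^sup>2 - (2 * real k)\<^sup>2)"
    using L by (simp add: field_simps)
  finally show ?thesis by (simp add: u_def L_def)
qed

text \<open>For each \<open>k\<close> the admissible \<open>m\<close> fill an interval of length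
  \<open>Y k\<close>, so rounding costs at most \<open>1\<close> per row. There are at most
  \<open>R / 2 + 1\<close> rows, and the lengths add up to the quarter-ellipse sum scaled by
  \<open>ln golden / pi\<close>.\<close>

lemma card_poles_Z_F:
  assumes R: "R > 0"
  shows "finite (poles Z_F \<inter> cball 0 R)"
    and "\<bar>real (card (poles Z_F \<inter> cball 0 R)) - ln golden / 8 * R\<^sup>2\<bar> \<le> (ln golden / pi + 1 / 2) * R + 1"
proof -
  define K where "K = nat \<lfloor>R / 2\<rfloor>"
  define L where "L = ln golden / pi"
  have L: "L > 0" using ln_golden_pos by (simp add: L_def)
  define Y where "Y k = L * sqrt (R\<^sup>2 - (2 * real k)\<^sup>2)" for k
  define M where "M k = {m::int. \<bar>2 * of_int m + real k\<bar> \<le> Y k}" for k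
  have K: "real K \<le> R / 2"
    using R unfolding K_def by linarith
  have Y: "Y k \<ge> 0" if "k \<le> K" for k
  proof -
    have "(2 * real k)\<^sup>2 \<le> R\<^sup>2"
      using that K by (intro power_mono) auto
    thus ?thesis using L by (simp add: Y_def)
  qed
  have M_eq: "M k = {m. (- Y k - real k) / 2 \<le> of_int m \<and> of_int m \<le> (Y k - real k) / 2}" for k
    unfolding M_def by (auto simp: abs_le_iff field_simps)
  have M: "finite (M k)" "\<bar>real (card (M k)) - Y k\<bar> \<le> 1" if "k \<le> K" for k
    using card_int_interval[of "(- Y k - real k) / 2" "(Y k - real k) / 2"] Y[OF that]
    unfolding M_eq by (auto simp: field_simps)
  have eq: "poles Z_F \<inter> cball 0 R = (\<lambda>(k, m). pole_F k m) ` (SIGMA k:{..K}. M k)"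
    using R pole_F_in_cball_iff[of R] unfolding poles_Z_F
    by (auto simp: M_def Y_def L_def K_def image_iff)
  show "finite (poles Z_F \<inter> cball 0 R)"
    unfolding eq using M(1) by (intro finite_imageI finite_SigmaI) auto
  have "inj_on (\<lambda>(k, m). pole_F k m) (SIGMA k:{..K}. M k)"
    by (auto simp: inj_on_def pole_F_eq_iff)
  hence "card (poles Z_F \<inter> cball 0 R) = card (SIGMA k:{..K}. M k)"
    unfolding eq by (rule card_image)
  also have "\<dots> = (\<Sum>k\<le>K. card (M k))"
    using M(1) by (intro card_SigmaI) auto
  finally have card: "real (card (poles Z_F \<inter> cball 0 R)) = (\<Sum>k\<le>K. real (card (M k)))"
    by simp
  have "\<bar>(\<Sum>k\<le>K. real (card (M k))) - (\<Sum>k\<le>K. Y k)\<bar> \<le> (\<Sum>k\<le>K. \<bar>real (card (M k)) - Y k\<bar>)"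
    unfolding sum_subtractf[symmetric] by (rule sum_abs)
  also have "\<dots> \<le> (\<Sum>k\<le>K. 1)"
    using M(2) by (intro sum_mono) auto
  also have "\<dots> \<le> R / 2 + 1"
    using K by simp
  finally have 1: "\<bar>(\<Sum>k\<le>K. real (card (M k))) - (\<Sum>k\<le>K. Y k)\<bar> \<le> R / 2 + 1" .
  define S where "S = (\<Sum>k\<le>K. sqrt (R\<^sup>2 - (2 * real k)\<^sup>2))"
  have "\<bar>S - pi / 8 * R\<^sup>2\<bar> \<le> R"
    unfolding S_def K_def by (rule sum_quarter_ellipse[OF R])
  hence "L * \<bar>S - pi / 8 * R\<^sup>2\<bar> \<le> L * R"
    using L by (intro mult_left_mono) auto
  moreover have "L * \<bar>S - pi / 8 * R\<^sup>2\<bar> = \<bar>L * S - ln golden / 8 * R\<^sup>2\<bar>"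
    using abs_mult[of L "S - pi / 8 * R\<^sup>2"] ln_golden_pos by (simp add: L_def algebra_simps)
  moreover have "L * S = (\<Sum>k\<le>K. Y k)"
    by (simp add: S_def Y_def sum_distrib_left)
  ultimately have 2: "\<bar>(\<Sum>k\<le>K. Y k) - ln golden / 8 * R\<^sup>2\<bar> \<le> L * R"
    by simp
  have "(ln golden / pi + 1 / 2) * R + 1 = L * R + (R / 2 + 1)"
    by (simp add: L_def algebra_simps)
  thus "\<bar>real (card (poles Z_F \<inter> cball 0 R)) - ln golden / 8 * R\<^sup>2\<bar> \<le> (ln golden / pi + 1 / 2) * R + 1"
    unfolding card using 1 2 by linarith
qed

lemma finite_poles_Z_F: "finite (poles Z_F \<inter> cball 0 R)"
proof (rule finite_subset)
  \<comment> \<open>\<open>card_poles_Z_F\<close> needs a positive radius, hence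
    \<open>max R 1\<close>.\<close>
  show "poles Z_F \<inter> cball 0 R \<subseteq> poles Z_F \<inter> cball 0 (max R 1)"
    by auto
qed (rule card_poles_Z_F, simp)

lemma pole_count_Z_F: "pole_count Z_F R = int (card (poles Z_F \<inter> cball 0 R))"
  unfolding pole_count_def by (simp add: zorder_Z_F_pole)

lemma pole_count_Z_F_bigo:
  "(\<lambda>R::real. real_of_int (pole_count Z_F R) - ln golden / 8 * R ^ 2) \<in> O[at_top](\<lambda>R. R)"
proof -
  have "(\<lambda>R::real. real_of_int (pole_count Z_F R) - ln golden / 8 * R ^ 2)
          \<in> O[at_top](\<lambda>R. (ln golden / pi + 1 / 2) * R + 1)"
  proof (rule bigoI[where c = 1])
    show "eventually (\<lambda>R. norm (real_of_int (pole_count Z_F R) - ln golden / 8 * R ^ 2) \<le>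
            1 * norm ((ln golden / pi + 1 / 2) * R + 1)) at_top"
      using eventually_gt_at_top[of 0]
    proof eventually_elim
      case (elim R)
      thus ?case
        using card_poles_Z_F(2)[of R] by (simp add: pole_count_Z_F)
    qed
  qed
  also have "(\<lambda>R::real. (ln golden / pi + 1 / 2) * R + 1) \<in> O[at_top](\<lambda>R. R)"
    using ln_golden_pos by real_asymp
  finally show ?thesis .
qed

theorem theorem9p1:
  shows
    "Xi_F holomorphic_on UNIV
   \<and> (\<forall>s. s \<notin> poles Z_F \<longrightarrow> Xi_F s = P_F s * Z_F s)
   \<and> zeros Xi_F = zeros Z_F
   \<and> (\<forall>s \<in> zeros Z_F. zorder Xi_F s = zorder Z_F s)
   \<and> poles Z_F = {pole_F k m | k m. True}
   \<and> (\<forall>k m.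
        Xi_F (pole_F k m) =
          q_F powi (- (int k * (int k + 1) div 2)) * qpoch_fin q_F k * qpoch_inf q_F q_F
            * 5 powr (pole_F k m / 2) * ((- pole_F k m) gchoose k)
        \<and> Xi_F (pole_F k m) \<noteq> 0)
   \<and> Limsup at_top (\<lambda>r::real. ereal (ln (max_modulus Xi_F r) / r ^ 2)) = ereal (ln golden / 4)
   \<and> growth_order Xi_F = 2
   \<and> growth_type 2 Xi_F = ereal (ln golden / 4)
   \<and> (\<forall>R. finite (poles Z_F \<inter> cball 0 R))
   \<and> (\<forall>R. finite (zeros Z_F \<inter> cball 0 R))
   \<and> (\<lambda>R::real. real_of_int (pole_count Z_F R) - ln golden / 8 * R ^ 2) \<in> O[at_top](\<lambda>R. R)
   \<and> (\<lambda>R::real. real_of_int (zero_count Z_F R)) \<in> O[at_top](\<lambda>R. R ^ 2)"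
proof (intro conjI allI ballI impI)
  show "Xi_F holomorphic_on UNIV"
    by (simp add: Xi_F_eq Xi_series_holomorphic)
  show "Xi_F s = P_F s * Z_F s" if "s \<notin> poles Z_F" for s
    using that by (simp add: poles_def is_pole_Z_F_iff Xi_F_eq Z_F_eq)
  show "Xi_F (pole_F k m) =
          q_F powi (- (int k * (int k + 1) div 2)) * qpoch_fin q_F k * qpoch_inf q_F q_F
            * 5 powr (pole_F k m / 2) * ((- pole_F k m) gchoose k)"
    and "Xi_F (pole_F k m) \<noteq> 0" for k m
    by (simp_all only: Xi_F_eq Xi_series_at_pole_F Xi_series_at_pole_F_nonzero[unfolded Xi_series_at_pole_F] not_False_eq_True)
qed (fact zeros_Xi_F zorder_Xi_F_zero poles_Z_F Limsup_ln_max_modulus_Xi_F growth_order_Xi_F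
       growth_type_Xi_F finite_poles_Z_F finite_zeros_Z_F pole_count_Z_F_bigo zero_count_Z_F_bigo)+

end
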